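(* Let $f(z)$ be a non-constant entire function with $\rho(f)<1$, let $\eta$ be a nonzero complex number, and let $a$ be a nonzero finite complex number. If $f(z)$ and $\Delta_{\eta}f(z)=f(z+\eta)-f(z)$ share the values $a$ and $-a$ IM, then $f(z)\equiv\Delta_{\eta}f(z)$.
   Context: Two non-constant meromorphic functions $f$ and $g$ share a value $c$ IM if $f-c$ and $g-c$ have the same zeros, ignoring multiplicities. The order of a meromorphic function $f$ is $\rho(f)=\limsup_{r\to\infty}\frac{\log^{+}T(r,f)}{\log r}$, where $T(r,f)$ is the Nevanlinna characteristic function. *)

theory Defs
  imports "HOL-Complex_Analysis.Complex_Analysis"
begin

definition log_plus :: "real \<Rightarrow> real" where
  "log_plus x = max 0 (ln x)"

text \<open>Nevanlinna characteristic of an entire function (no poles, so N(r,f) = 0 and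
  T(r,f) = m(r,f) is the proximity function).\<close>
definition nevanlinna_T :: "(complex \<Rightarrow> complex) \<Rightarrow> real \<Rightarrow> real" where
  "nevanlinna_T f r = (1 / (2 * pi)) *
     integral {0..2*pi} (\<lambda>t. log_plus (cmod (f (of_real r * cis t))))"

definition order_of :: "(complex \<Rightarrow> complex) \<Rightarrow> ereal" where
  "order_of f = Limsup at_top (\<lambda>r. ereal (log_plus (nevanlinna_T f r) / ln r))"

definition shares_IM :: "(complex \<Rightarrow> complex) \<Rightarrow> (complex \<Rightarrow> complex) \<Rightarrow> complex \<Rightarrow> bool" where
  "shares_IM f g c \<longleftrightarrow> {z. f z = c} = {z. g z = c}"

end

theory Submission
  imports Defs "HOL-Real_Asymp.Real_Asymp"
begin

text \<open>
  Write \<open>g = \<Delta>f\<close> and consider \<open>\<Phi> = f' (f - g) / (f\<^sup>2 - a\<^sup>2)\<close>. At a zero of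
  \<open>f\<^sup>2 - a\<^sup>2\<close> of order \<open>m\<close>, \<open>f'\<close> vanishes to order \<open>m - 1\<close> and, by the sharing
  hypothesis, \<open>f - g\<close> vanishes too; hence \<open>\<Phi>\<close> is entire. On the other hand
  \<open>\<Phi> = 1/2 (f'/(f - a) + f'/(f + a)) (1 - g/f)\<close>. Because \<open>f\<close> has order less than one, there are
  arbitrarily large circles near which the logarithmic derivatives of \<open>f\<close> and \<open>f \<plusminus> a\<close> are
  uniformly small, so that \<open>f(z + \<eta>)/f(z)\<close> is bounded there and \<open>\<Phi>\<close> is small. By the maximum
  principle \<open>\<Phi> = 0\<close>, and \<open>f\<close> being non-constant this forces \<open>f = g\<close>.

  The circles are found by averaging: dividing out the zeros \<open>w\<^sub>i\<close> in a disc of radius \<open>R\<close> by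
  Blaschke factors and applying the Schwarz integral formula bounds \<open>h'/h\<close> by
  \<open>O(T(R)/R) + 3 \<Sum> ln (R/|w\<^sub>i|)/|z - w\<^sub>i|\<close>, where \<open>\<Sum> ln (R/|w\<^sub>i|) \<le> T(R) + O(1)\<close> by Jensen's
  formula. The average of the sum over integer radii is \<open>O(T(R) ln R / R)\<close>, which tends to 0.
\<close>

subsection \<open>The Schwarz integral bound\<close>

lemma circle_mean_value:
  assumes "continuous_on (cball 0 R) L" "L holomorphic_on ball 0 R" "R > 0"
  shows "((\<lambda>t. L (of_real R * cis t)) has_integral 2 * of_real pi * L 0) {0..2*pi}"
proof -
  have "((\<lambda>u. L u / (u - 0)) has_contour_integral (2 * of_real pi * \<i> * L 0)) (circlepath 0 R)"
    by (rule Cauchy_integral_circlepath) (use assms in auto)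
  then have "((\<lambda>t. L (of_real R * cis t) / (of_real R * cis t) * R * \<i> * cis t) has_integral
      (2 * of_real pi * \<i> * L 0)) {0..2*pi}"
    unfolding circlepath_def by (subst (asm) has_contour_integral_part_circlepath_iff) auto
  also have "(\<lambda>t. L (of_real R * cis t) / (of_real R * cis t) * R * \<i> * cis t)
      = (\<lambda>t. \<i> * L (of_real R * cis t))"
    using assms(3) by (auto simp: field_simps)
  finally have "((\<lambda>t. (-\<i>) * (\<i> * L (of_real R * cis t))) has_integral
      (-\<i>) * (2 * of_real pi * \<i> * L 0)) {0..2*pi}"
    by (rule has_integral_mult_right)
  then show ?thesis by (simp add: algebra_simps)
qed

lemma circle_deriv_value:
  assumes "continuous_on (cball 0 R) L" "L holomorphic_on ball 0 R" "cmod z < R"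
  shows "((\<lambda>t. L (of_real R * cis t) * (of_real R * cis t / (of_real R * cis t - z)^2))
           has_integral 2 * of_real pi * deriv L z) {0..2*pi}"
proof -
  have "((\<lambda>u. L u / (u - z)^(Suc 1)) has_contour_integral
      ((2 * pi * \<i>) / (fact 1) * (deriv ^^ 1) L z)) (circlepath 0 R)"
    by (rule Cauchy_has_contour_integral_higher_derivative_circlepath) (use assms in auto)
  then have "((\<lambda>u. L u / (u - z)^2) has_contour_integral (2 * of_real pi * \<i> * deriv L z))
      (circlepath 0 R)"
    by (simp add: power2_eq_square)
  then have "((\<lambda>t. L (of_real R * cis t) / (of_real R * cis t - z)^2 * R * \<i> * cis t) has_integral
      (2 * of_real pi * \<i> * deriv L z)) {0..2*pi}"
    unfolding circlepath_def by (subst (asm) has_contour_integral_part_circlepath_iff) auto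
  then have "((\<lambda>t. (-\<i>) * (L (of_real R * cis t) / (of_real R * cis t - z)^2 * R * \<i> * cis t))
      has_integral (-\<i>) * (2 * of_real pi * \<i> * deriv L z)) {0..2*pi}"
    by (rule has_integral_mult_right)
  moreover have "(\<lambda>t. (-\<i>) * (L (of_real R * cis t) / (of_real R * cis t - z)^2 * R * \<i> * cis t))
    = (\<lambda>t. L (of_real R * cis t) * (of_real R * cis t / (of_real R * cis t - z)^2))"
    by (auto simp: field_simps)
  ultimately show ?thesis by (simp add: algebra_simps)
qed

text \<open>On \<open>cmod u = R\<close> one has \<open>cnj u = R^2 / u\<close>, so the conjugate of
  the integrand is the boundary value of \<open>F\<close>. This \<open>F\<close> is holomorphic in
  the disc because \<open>cmod z < R\<close> keeps \<open>R^2 - cnj z * u\<close> away from zero,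
  and \<open>F 0 = 0\<close>, so the mean value property yields 0.\<close>

lemma cnj_circle_deriv_value:
  assumes "continuous_on (cball 0 R) L" "L holomorphic_on ball 0 R" "cmod z < R"
  shows "((\<lambda>t. cnj (L (of_real R * cis t)) * (of_real R * cis t / (of_real R * cis t - z)^2))
           has_integral 0) {0..2*pi}"
proof -
  have R: "R > 0" using assms(3) norm_ge_zero[of z] by linarith
  define F where "F = (\<lambda>u. L u * (u * of_real (R^2) / (of_real (R^2) - cnj z * u)^2))"
  have nz: "of_real (R^2) - cnj z * u \<noteq> 0" if "cmod u \<le> R" for u
  proof
    assume "of_real (R^2) - cnj z * u = 0"
    then have "cnj z * u = of_real (R^2)" by simp
    then have "cmod z * cmod u = R^2"
      by (metis complex_mod_cnj norm_mult norm_of_real abs_power2 power2_abs abs_of_nonneg zero_le_power2)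
    moreover have "cmod z * cmod u \<le> cmod z * R"
      using that by (simp add: mult_left_mono)
    moreover have "cmod z * R < R * R"
      using assms(3) R by simp
    ultimately show False by (simp add: power2_eq_square)
  qed
  have "((\<lambda>t. F (of_real R * cis t)) has_integral 2 * of_real pi * F 0) {0..2*pi}"
  proof (rule circle_mean_value)
    show "continuous_on (cball 0 R) F" unfolding F_def
      by (intro continuous_intros assms) (use nz in auto)
    show "F holomorphic_on ball 0 R" unfolding F_def
      by (intro holomorphic_intros assms) (use nz in auto)
  qed fact
  then have *: "((\<lambda>t. F (of_real R * cis t)) has_integral 0) {0..2*pi}"
    by (simp add: F_def)
  have "((cnj \<circ> (\<lambda>t. F (of_real R * cis t))) has_integral cnj 0) {0..2*pi}"
    by (rule has_integral_linear[OF * bounded_linear_cnj])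
  moreover have "cnj (F (of_real R * cis t)) =
      cnj (L (of_real R * cis t)) * (of_real R * cis t / (of_real R * cis t - z)^2)" for t
  proof -
    define u where "u = of_real R * cis t"
    have "cmod u = R" using R by (simp add: u_def norm_mult)
    then have u: "u * cnj u = of_real (R^2)"
      by (simp add: complex_norm_square[symmetric])
    have "u - z \<noteq> 0" "u \<noteq> 0" using assms(3) R \<open>cmod u = R\<close> by auto
    have "cnj (u * of_real (R^2) / (of_real (R^2) - cnj z * u)^2) = cnj u * of_real (R^2) / (of_real (R^2) - z * cnj u)^2"
      by simp
    also have "\<dots> = cnj u * (u * cnj u) / ((u - z) * cnj u)^2"
      unfolding u[symmetric] by (simp add: algebra_simps)
    also have "\<dots> = u / (u - z)^2"
      using \<open>u \<noteq> 0\<close> by (simp add: power_mult_distrib power2_eq_square)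
    finally show ?thesis unfolding F_def u_def[symmetric]
      by (simp only: complex_cnj_mult[of "L u"])
  qed
  ultimately show ?thesis by (simp add: o_def)
qed

text \<open>Adding the vanishing conjugate integral to Cauchy's formula for \<open>deriv L z\<close>
  replaces \<open>L\<close> by \<open>2 * Re L\<close> against the same kernel, whose modulus is at
  most \<open>R / (R - cmod z)^2\<close>. Only the real part, the logarithm of a modulus in the
  application, has to be controlled.\<close>

lemma deriv_le_integral_Re:
  assumes "continuous_on (cball 0 R) L" "L holomorphic_on ball 0 R" "cmod z < R"
  shows "cmod (deriv L z) \<le>
    R / (pi * (R - cmod z)^2) * integral {0..2*pi} (\<lambda>t. \<bar>Re (L (of_real R * cis t))\<bar>)"
proof -
  have R: "R > 0" using assms(3) norm_ge_zero[of z] by linarith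
  let ?k = "\<lambda>t. of_real R * cis t / (of_real R * cis t - z)^2"
  let ?g = "\<lambda>t. of_real (2 * Re (L (of_real R * cis t))) * ?k t"
  have "((\<lambda>t. L (of_real R * cis t) * ?k t + cnj (L (of_real R * cis t)) * ?k t)
          has_integral 2 * of_real pi * deriv L z + 0) {0..2*pi}"
    by (intro has_integral_add circle_deriv_value cnj_circle_deriv_value assms)
  moreover have "(\<lambda>t. L (of_real R * cis t) * ?k t + cnj (L (of_real R * cis t)) * ?k t) = ?g"
    by (simp only: distrib_right[symmetric] complex_add_cnj)
  ultimately have *: "(?g has_integral 2 * of_real pi * deriv L z) {0..2*pi}" by simp
  have circ: "of_real R * cis t \<in> cball 0 R" for t using R by (simp add: norm_mult)
  have contR: "continuous_on {0..2*pi} (\<lambda>t. \<bar>Re (L (of_real R * cis t))\<bar>)"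
    by (intro continuous_intros continuous_on_compose2[OF assms(1)]) (use circ in auto)
  have "cmod (integral {0..2*pi} ?g) \<le>
      integral {0..2*pi} (\<lambda>t. (2 * R / (R - cmod z)^2) * \<bar>Re (L (of_real R * cis t))\<bar>)"
  proof (rule integral_norm_bound_integral)
    show "?g integrable_on {0..2*pi}" using * by blast
    show "(\<lambda>t. (2 * R / (R - cmod z)^2) * \<bar>Re (L (of_real R * cis t))\<bar>) integrable_on {0..2*pi}"
      by (intro integrable_continuous_interval continuous_intros contR)
    fix t
    have "R - cmod z \<le> cmod (of_real R * cis t - z)"
      using norm_triangle_ineq2[of "of_real R * cis t" z] R by (simp add: norm_mult)
    then have "cmod (?k t) \<le> R / (R - cmod z)^2"
      using assms(3) R by (auto simp: norm_mult norm_divide norm_power intro!: divide_left_mono power_mono mult_pos_pos)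
    then have "cmod (?g t) \<le> (2 * \<bar>Re (L (of_real R * cis t))\<bar>) * (R / (R - cmod z)^2)"
      unfolding norm_mult by (intro mult_mono) auto
    then show "cmod (?g t) \<le> (2 * R / (R - cmod z)^2) * \<bar>Re (L (of_real R * cis t))\<bar>"
      by (simp add: mult_ac)
  qed
  also have "integral {0..2*pi} ?g = 2 * of_real pi * deriv L z"
    using * by (rule integral_unique)
  finally have "2 * pi * cmod (deriv L z) \<le> 2 * (R / (R - cmod z)^2 *
      integral {0..2*pi} (\<lambda>t. \<bar>Re (L (of_real R * cis t))\<bar>))"
    by (simp add: norm_mult mult_ac)
  moreover have "d \<le> X / pi" if "2 * pi * d \<le> 2 * X" for d X :: real
    using that by (simp add: pos_le_divide_eq mult_ac)
  ultimately have "cmod (deriv L z) \<le> (R / (R - cmod z)^2 *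
      integral {0..2*pi} (\<lambda>t. \<bar>Re (L (of_real R * cis t))\<bar>)) / pi"
    by blast
  then show ?thesis by (simp add: mult_ac)
qed

subsection \<open>The Nevanlinna characteristic of an entire function\<close>

lemma log_plus_eq: "x \<ge> 0 \<Longrightarrow> log_plus x = ln (max 1 x)"
  by (cases "x = 0") (auto simp: log_plus_def max_def)

lemma log_plus_mono: "0 \<le> x \<Longrightarrow> x \<le> y \<Longrightarrow> log_plus x \<le> log_plus y"
  by (auto simp: log_plus_eq)

lemma log_plus_nonneg: "log_plus x \<ge> 0"
  by (simp add: log_plus_def)

lemma abs_ln_eq_log_plus: "x > 0 \<Longrightarrow> \<bar>ln x\<bar> = 2 * log_plus x - ln x"
  by (auto simp: log_plus_def)

lemma log_plus_add_le:
  assumes "x \<ge> 0" "y \<ge> 0"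
  shows "log_plus (x + y) \<le> log_plus x + log_plus y + ln 2"
proof -
  have "x \<le> max 1 x * max 1 y" "y \<le> max 1 x * max 1 y" "1 \<le> max 1 x * max 1 y"
    using mult_mono[of x "max 1 x" 1 "max 1 y"] mult_mono[of 1 "max 1 x" y "max 1 y"]
      mult_mono[of 1 "max 1 x" 1 "max 1 y"] assms by auto
  then have "max 1 (x + y) \<le> (max 1 x * max 1 y) * 2"
    using assms by auto
  then have "ln (max 1 (x + y)) \<le> ln (max 1 x * max 1 y * 2)"
    by (subst ln_le_cancel_iff) (auto simp: max_def)
  then show ?thesis using assms by (simp add: log_plus_eq ln_mult max_def split: if_splits)
qed

lemma continuous_on_log_plus_circle:
  assumes "continuous_on UNIV f"
  shows "continuous_on A (\<lambda>t. log_plus (cmod (f (of_real r * cis t))))"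
  unfolding log_plus_eq[OF norm_ge_zero]
  by (intro continuous_intros continuous_on_compose2[OF assms]) (auto simp: max_def)

lemma nevanlinna_T_mono:
  assumes "continuous_on UNIV f" "continuous_on UNIV g"
    and "\<And>z. cmod z = \<bar>r\<bar> \<Longrightarrow> log_plus (cmod (f z)) \<le> log_plus (cmod (g z)) + c"
  shows "nevanlinna_T f r \<le> nevanlinna_T g r + c"
proof -
  have "integral {0..2*pi} (\<lambda>t. log_plus (cmod (f (of_real r * cis t)))) \<le>
    integral {0..2*pi} (\<lambda>t. log_plus (cmod (g (of_real r * cis t))) + c)"
    by (intro integral_le integrable_continuous_interval continuous_intros
          continuous_on_log_plus_circle assms) (auto simp: norm_mult)
  also have "\<dots> = integral {0..2*pi} (\<lambda>t. log_plus (cmod (g (of_real r * cis t)))) + 2 * pi * c"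
    by (subst integral_add)
      (auto intro!: integrable_continuous_interval continuous_on_log_plus_circle assms)
  finally show ?thesis
    by (simp add: nevanlinna_T_def field_simps)
qed

lemma nevanlinna_T_nonneg: "continuous_on UNIV f \<Longrightarrow> nevanlinna_T f r \<ge> 0"
  unfolding nevanlinna_T_def
  by (intro mult_nonneg_nonneg integral_nonneg integrable_continuous_interval
        continuous_on_log_plus_circle) (auto simp: log_plus_nonneg)

subsection \<open>Zeros and the logarithmic derivative\<close>

lemma entire_factor_zero:
  assumes "f holomorphic_on UNIV" "f z0 \<noteq> 0"
  obtains m :: nat and g where "g holomorphic_on UNIV" "g p \<noteq> 0" "\<And>z. f z = (z - p) ^ m * g z"
proof (cases "f p = 0")
  case False
  then show ?thesis using that[of f 0] assms by simp
next
  case True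
  then have "\<not> f constant_on UNIV" using assms(2) by (metis UNIV_I constant_on_def)
  then obtain g r n where g: "0 < n" "0 < r" "g holomorphic_on ball p r"
      "\<And>w. w \<in> ball p r \<Longrightarrow> f w = (w - p) ^ n * g w" "\<And>w. w \<in> ball p r \<Longrightarrow> g w \<noteq> 0"
    using holomorphic_factor_zero_nonconstant[of f UNIV p] assms(1) True
    by (metis UNIV_I connected_UNIV open_UNIV)
  \<comment> \<open>The local cofactor near \<open>p\<close> and the global quotient away from
    \<open>p\<close> agree on the overlap, so they glue to an entire function.\<close>
  define G where "G = (\<lambda>z. if z \<in> ball p r then g z else f z / (z - p) ^ n)"
  have eq: "G z = f z / (z - p) ^ n" if "z \<in> - {p}" for z
    using that g(4)[of z] by (auto simp: G_def)
  have "G holomorphic_on ball p r \<union> - {p}"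
  proof (rule holomorphic_on_Un)
    show "G holomorphic_on ball p r"
      using g(3) by (rule holomorphic_transform) (auto simp: G_def)
    have "(\<lambda>z. f z / (z - p) ^ n) holomorphic_on - {p}"
      by (intro holomorphic_intros holomorphic_on_subset[OF assms(1)]) auto
    then show "G holomorphic_on - {p}"
      by (rule holomorphic_transform) (simp add: eq)
  qed auto
  moreover have "ball p r \<union> - {p} = UNIV" using g(2) by auto
  moreover have "G p \<noteq> 0" using g(2,5) by (simp add: G_def)
  moreover have "f z = (z - p) ^ n * G z" for z
    using g(4)[of z] g(2) by (cases "z = p") (auto simp: eq G_def)
  ultimately show ?thesis using that[of G n] by simp
qed

text \<open>A compact set contains finitely many zeros, and these are split off one point at a time.
  A zero of multiplicity \<open>m\<close> appears \<open>m\<close> times in the list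
  \<open>w\<close>; zeros outside \<open>K\<close> stay in \<open>g\<close>.\<close>

lemma entire_factorization_on_compact:
  assumes f: "f holomorphic_on UNIV" "f z0 \<noteq> 0" and K: "compact K"
  obtains n :: nat and w g where "g holomorphic_on UNIV" "\<And>z. z \<in> K \<Longrightarrow> g z \<noteq> 0"
    "\<And>i. i < n \<Longrightarrow> w i \<in> K \<and> f (w i) = 0" "\<And>z. f z = (\<Prod>i<n. z - w i) * g z"
proof -
  let ?Z = "{z \<in> K. f z = 0}"
  have fin: "finite ?Z"
  proof (cases "f constant_on UNIV")
    case True
    then have "f z \<noteq> 0" for z using f(2) by (metis UNIV_I constant_on_def)
    then have "?Z = {}" by auto
    then show ?thesis by (simp only: finite.emptyI)
  next
    case False
    then show ?thesis using holomorphic_compact_finite_zeros[of f UNIV K] f K connected_UNIV by blast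
  qed
  have "\<exists>(n::nat) w g. g holomorphic_on UNIV \<and> (\<forall>z\<in>Z. g z \<noteq> 0) \<and> (\<forall>i<n. w i \<in> Z) \<and>
      (\<forall>z. f z = (\<Prod>i<n. z - w i) * g z)" if "finite Z" for Z
    using that
  proof (induction Z)
    case empty
    show ?case
      by (rule exI[of _ "0::nat"], rule exI[of _ "\<lambda>_. 0"], rule exI[of _ f], simp add: f)
  next
    case (insert p Z)
    then obtain n w g where g: "g holomorphic_on UNIV" "\<forall>z\<in>Z. g z \<noteq> 0" "\<forall>i<n::nat. w i \<in> Z"
      "\<forall>z. f z = (\<Prod>i<n. z - w i) * g z" by blast
    have "g z0 \<noteq> 0" using g(4) f(2) by auto
    then obtain m G where G: "G holomorphic_on UNIV" "G p \<noteq> 0" "\<And>z. g z = (z - p) ^ m * G z"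
      using entire_factor_zero[OF g(1)] by metis
    define v where "v = (\<lambda>i. if i < n then w i else p)"
    have prod: "(\<Prod>i<n + m. z - v i) = (\<Prod>i<n. z - w i) * (z - p) ^ m" for z
      by (induction m) (auto simp: v_def mult_ac)
    show ?case
    proof (intro exI conjI allI impI ballI)
      show "G holomorphic_on UNIV" by fact
      show "G z \<noteq> 0" if "z \<in> insert p Z" for z using that G g(2) by auto
      show "v i \<in> insert p Z" if "i < n + m" for i using g(3) by (auto simp: v_def)
      show "f z = (\<Prod>i<n + m. z - v i) * G z" for z using g(4) G(3) by (simp add: prod mult_ac)
    qed
  qed
  from this[OF fin] obtain n w g where g: "g holomorphic_on UNIV" "\<forall>z\<in>?Z. g z \<noteq> 0"
    "\<forall>i<n::nat. w i \<in> ?Z" "\<forall>z. f z = (\<Prod>i<n. z - w i) * g z" by blast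
  show ?thesis
  proof (rule that[of g n w])
    show "g z \<noteq> 0" if "z \<in> K" for z
    proof
      assume "g z = 0"
      then have "z \<in> ?Z" using that g(4)[rule_format, of z] by simp
      then show False using g(2) \<open>g z = 0\<close> by blast
    qed
    show "w i \<in> K \<and> f (w i) = 0" if "i < n" for i using g(3) that by blast
    show "f z = (\<Prod>i<n. z - w i) * g z" for z using g(4) by blast
  qed (rule g(1))
qed

section \<open>Blaschke factors and the logarithmic derivative\<close>

lemma has_field_derivative_prod_log:
  assumes "\<And>i. i < n \<Longrightarrow> (b i has_field_derivative b i z * q i) (at z)"
  shows "((\<lambda>z. \<Prod>i<n::nat. b i z) has_field_derivative (\<Prod>i<n. b i z) * (\<Sum>i<n. q i)) (at z)"
  using assms
proof (induction n)
  case (Suc n)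
  have "((\<lambda>z. (\<Prod>i<n. b i z) * b n z) has_field_derivative
     (\<Prod>i<n. b i z) * (b n z * q n) + (\<Prod>i<n. b i z) * (\<Sum>i<n. q i) * b n z) (at z)"
    by (rule DERIV_mult') (use Suc in auto)
  then show ?case by (simp add: algebra_simps)
qed auto

text \<open>The derivative is written as value times logarithmic derivative, the shape that
  \<open>has_field_derivative_prod_log\<close> sums over a product.\<close>

lemma has_field_derivative_Blaschke_factor:
  fixes w z :: complex
  assumes "z \<noteq> w" "of_real (R^2) - cnj w * z \<noteq> 0"
  shows "((\<lambda>z. of_real R * (z - w) / (of_real (R^2) - cnj w * z)) has_field_derivative
     of_real R * (z - w) / (of_real (R^2) - cnj w * z) *
       (of_real (R^2 - (cmod w)^2) / ((z - w) * (of_real (R^2) - cnj w * z)))) (at z)"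
proof -
  define D where "D = of_real (R^2) - cnj w * z"
  have "((\<lambda>z. of_real R * (z - w) / (of_real (R^2) - cnj w * z)) has_field_derivative
     (of_real R * D + of_real R * (z - w) * cnj w) / D^2) (at z)"
    using assms unfolding D_def
    by (auto intro!: derivative_eq_intros simp: power2_eq_square)
  moreover have "of_real R * D + of_real R * (z - w) * cnj w = of_real R * of_real (R^2 - (cmod w)^2)"
    using complex_norm_square[of w] by (simp add: D_def algebra_simps)
  ultimately have "((\<lambda>z. of_real R * (z - w) / (of_real (R^2) - cnj w * z)) has_field_derivative
     of_real R * of_real (R^2 - (cmod w)^2) / D^2) (at z)" by simp
  moreover have "of_real R * of_real (R^2 - (cmod w)^2) / D^2 = of_real R * (z - w) / D *
       (of_real (R^2 - (cmod w)^2) / ((z - w) * D))"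
    using assms by (simp add: power2_eq_square)
  ultimately show ?thesis unfolding D_def by metis
qed

text \<open>For \<open>cmod z <= R / 4\<close> the second factor of the denominator is at least
  \<open>3/4 * R^2\<close>, while \<open>1 - x <= - ln x\<close> at \<open>x = cmod w / R\<close>
  bounds the numerator by \<open>2 * R^2 * ln (R / cmod w)\<close>. The quotient 8/3 is rounded up
  to 3. The weight \<open>ln (R / cmod w)\<close> is chosen because Jensen's formula controls its
  sum over the zeros.\<close>

lemma norm_Blaschke_log_deriv_le:
  assumes "0 < cmod w" "cmod w < R" "cmod z \<le> R / 4" "z \<noteq> w"
  shows "cmod (of_real (R^2 - (cmod w)^2) / ((z - w) * (of_real (R^2) - cnj w * z)))
           \<le> 3 * (ln (R / cmod w) / cmod (z - w))"
proof -
  have R: "R > 0" using assms by linarith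
  have "cmod (cnj w * z) \<le> R * (R / 4)"
    unfolding norm_mult complex_mod_cnj using assms R by (intro mult_mono) auto
  then have d: "3/4 * R^2 \<le> cmod (of_real (R^2) - cnj w * z)"
    using norm_triangle_ineq2[of "of_real (R^2)" "cnj w * z"] unfolding norm_of_real
    by (simp add: power2_eq_square)
  have "R^2 - (cmod w)^2 = (R + cmod w) * (R - cmod w)" by (simp add: power2_eq_square algebra_simps)
  also have "\<dots> \<le> (2 * R) * (R - cmod w)" using assms by (intro mult_right_mono) auto
  also have "\<dots> = 2 * R^2 * (1 - cmod w / R)" using R by (simp add: field_simps power2_eq_square)
  also have "1 - cmod w / R \<le> ln (R / cmod w)"
    using ln_le_minus_one[of "cmod w / R"] assms R by (simp add: ln_div)
  finally have n: "R^2 - (cmod w)^2 \<le> 2 * R^2 * ln (R / cmod w)" using R by simp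
  have n0: "0 \<le> R^2 - (cmod w)^2" using assms by (simp add: power_mono)
  have "cmod (of_real (R^2 - (cmod w)^2) / ((z - w) * (of_real (R^2) - cnj w * z)))
    = (R^2 - (cmod w)^2) / cmod (of_real (R^2) - cnj w * z) / cmod (z - w)"
    using n0 by (simp only: norm_divide norm_mult norm_of_real abs_of_nonneg) (simp add: mult.commute)
  also have "\<dots> \<le> (2 * R^2 * ln (R / cmod w)) / (3/4 * R^2) / cmod (z - w)"
    using n d n0 R by (intro divide_right_mono frac_le order_trans[OF n0 n]) auto
  also have "\<dots> = 8/3 * (ln (R / cmod w) / cmod (z - w))" using R by (simp add: field_simps)
  also have "\<dots> \<le> 3 * (ln (R / cmod w) / cmod (z - w))"
    using assms by (intro mult_right_mono divide_nonneg_nonneg) auto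
  finally show ?thesis .
qed

text \<open>A differentiated Poisson-Jensen formula: \<open>h\<close> is a zero-free function
  \<open>G = exp L\<close> times a Blaschke product. The Schwarz bound handles
  \<open>deriv L\<close>, and each zero contributes one term of the sum. The bound \<open>J\<close>
  has twice the characteristic because the mean of \<open>\<bar>ln (cmod h)\<bar>\<close> on the
  circle is \<open>2 * nevanlinna_T h R\<close> minus the mean of
  \<open>ln (cmod h)\<close>.\<close>

lemma log_deriv_estimate:
  assumes h: "h holomorphic_on UNIV" "h 0 \<noteq> 0" and R: "R > 0"
    and sph: "\<And>z. cmod z = R \<Longrightarrow> h z \<noteq> 0"
    and J: "2 * nevanlinna_T h R - ln (cmod (h 0)) \<le> J"
  obtains n :: nat and w where "\<And>i. i < n \<Longrightarrow> 0 < cmod (w i) \<and> cmod (w i) < R"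
    "(\<Sum>i<n. ln (R / cmod (w i))) \<le> J"
    "\<And>z. cmod z \<le> R / 4 \<Longrightarrow> z \<notin> w ` {..<n} \<Longrightarrow> h z \<noteq> 0 \<and>
       cmod (deriv h z / h z) \<le> 4 * J / R + 3 * (\<Sum>i<n. ln (R / cmod (w i)) / cmod (z - w i))"
proof -
  obtain n :: nat and w g where g: "g holomorphic_on UNIV" "\<And>z. z \<in> cball 0 R \<Longrightarrow> g z \<noteq> 0"
    and w: "\<And>i. i < n \<Longrightarrow> w i \<in> cball 0 R \<and> h (w i) = 0"
    and hg: "\<And>z. h z = (\<Prod>i<n. z - w i) * g z"
    by (rule entire_factorization_on_compact[OF h compact_cball[of 0 R]]) (rule that; assumption)
  have w: "0 < cmod (w i)" "cmod (w i) < R" if "i < n" for i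
    using w[OF that] sph[of "w i"] h(2) by (auto simp: less_le)
  have nz: "of_real (R^2) - cnj (w i) * z \<noteq> 0" if "i < n" "cmod z \<le> R" for i z
  proof
    assume "of_real (R^2) - cnj (w i) * z = 0"
    then have "cmod (of_real (R^2)) = cmod (cnj (w i) * z)" by simp
    then have "R^2 = cmod (w i) * cmod z" by (simp add: norm_mult norm_power)
    moreover have "cmod (w i) * cmod z \<le> cmod (w i) * R" using that by (simp add: mult_left_mono)
    moreover have "cmod (w i) * R < R * R" using w(2)[OF that(1)] R by simp
    ultimately show False by (simp add: power2_eq_square)
  qed
  \<comment> \<open>Each factor \<open>z - w i\<close> is replaced by
    \<open>(R^2 - cnj (w i) * z) / R\<close>, which has the same modulus on the circle and no zero
    in the closed disc. Thus \<open>G\<close> is \<open>h\<close> divided by its Blaschke product,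
    written without division by zero at the \<open>w i\<close>.\<close>
  define G where "G = (\<lambda>z. g z * (\<Prod>i<n. (of_real (R^2) - cnj (w i) * z) / of_real R))"
  have G: "G holomorphic_on UNIV" unfolding G_def
    by (intro holomorphic_intros g) (use R in auto)
  have Gnz: "G z \<noteq> 0" if "cmod z \<le> R" for z
    using that g(2)[of z] nz[of _ z] R by (auto simp: G_def)
  \<comment> \<open>A zero-free disc slightly larger than \<open>cball 0 R\<close> makes the
    logarithm \<open>L\<close> continuous up to the circle. Compactness gives a uniform margin
    \<open>e\<close>; a point outside the closed disc is compared with its radial projection
    \<open>x\<close>.\<close>
  obtain S where S: "S > R" "\<And>z. cmod z < S \<Longrightarrow> G z \<noteq> 0"
  proof -
    have "open (G -` (- {0}))"
      using G holomorphic_on_imp_continuous_on open_vimage by blast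
    then obtain e where e: "e > 0" "(\<Union>x\<in>cball 0 R. ball x e) \<subseteq> G -` (- {0})"
      by (rule compact_subset_open_imp_ball_epsilon_subset[OF compact_cball[of 0 R]])
        (use Gnz in \<open>auto intro: that\<close>)
    have "G z \<noteq> 0" if z: "cmod z < R + e" for z
    proof (cases "cmod z \<le> R")
      case False
      then have "z \<noteq> 0" using R by auto
      define x where "x = of_real (R / cmod z) * z"
      have "cmod x = R" using \<open>z \<noteq> 0\<close> R by (simp add: x_def norm_mult norm_divide)
      have "z - x = of_real (1 - R / cmod z) * z" by (simp add: x_def algebra_simps)
      then have "cmod (z - x) = \<bar>1 - R / cmod z\<bar> * cmod z" by (simp only: norm_mult norm_of_real)
      also have "\<bar>1 - R / cmod z\<bar> = 1 - R / cmod z" using False \<open>z \<noteq> 0\<close> by (simp add: field_simps)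
      finally have "cmod (z - x) = cmod z - R" using \<open>z \<noteq> 0\<close> by (simp add: left_diff_distrib)
      with \<open>cmod x = R\<close> have "z \<in> (\<Union>x\<in>cball 0 R. ball x e)"
        using z by (auto simp: dist_norm norm_minus_commute intro!: bexI[of _ x])
      then have "z \<in> G -` (- {0})" using e(2) by (rule rev_subsetD)
      then show ?thesis by simp
    qed (use Gnz in auto)
    then show ?thesis using that[of "R + e"] e by simp
  qed
  obtain L where L: "L holomorphic_on ball 0 S" "\<And>z. z \<in> ball 0 S \<Longrightarrow> exp (L z) = G z"
    by (rule holomorphic_logarithm_exists[of "ball 0 S" G 0])
      (use S R holomorphic_on_subset[OF G] in auto)
  have LR: "continuous_on (cball 0 R) L" "L holomorphic_on ball 0 R"
    using L(1) S(1) by (auto intro!: holomorphic_on_imp_continuous_on elim!: holomorphic_on_subset)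
  have ReL: "Re (L z) = ln (cmod (G z))" if "cmod z < S" for z
    using L(2)[of z] that by (metis ln_exp mem_ball_0 norm_exp_eq_Re)
  have Ghcirc: "cmod (G z) = cmod (h z)" if z: "cmod z = R" for z
  proof -
    have "cmod ((of_real (R^2) - cnj (w i) * z) / of_real R) = cmod (z - w i)" for i
    proof -
      have "of_real (R^2) = z * cnj z" using z by (simp add: complex_norm_square[symmetric])
      then have "of_real (R^2) - cnj (w i) * z = z * cnj (z - w i)" by (simp add: algebra_simps)
      then show ?thesis using z R by (simp add: norm_divide norm_mult del: complex_cnj_diff)
    qed
    then show ?thesis by (simp add: G_def hg norm_mult prod_norm[symmetric] mult.commute)
  qed
  define \<Lambda> where "\<Lambda> = (\<Sum>i<n. ln (R / cmod (w i)))"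
  have G0: "ln (cmod (G 0)) = ln (cmod (h 0)) + \<Lambda>"
  proof -
    have "cmod (G 0) = cmod (g 0) * (\<Prod>i<n. R)"
      using R by (simp add: G_def norm_mult norm_power power2_eq_square)
    also have "(\<Prod>i<n. R) = (\<Prod>i<n. cmod (w i)) * (\<Prod>i<n. R / cmod (w i))"
      using w(1) by (auto simp: prod.distrib[symmetric] intro!: prod.cong)
    finally have "cmod (G 0) = cmod (h 0) * (\<Prod>i<n. R / cmod (w i))"
      by (simp add: hg norm_mult prod_norm[symmetric] mult_ac)
    moreover have "ln (\<Prod>i<n. R / cmod (w i)) = \<Lambda>"
      unfolding \<Lambda>_def using w R by (intro ln_prod) auto
    moreover have "(\<Prod>i<n. R / cmod (w i)) > 0" using w R by (intro prod_pos) auto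
    ultimately show ?thesis using h(2) by (metis ln_mult_pos zero_less_norm_iff)
  qed
  let ?lp = "\<lambda>t. log_plus (cmod (h (of_real R * cis t)))"
  have circ: "cmod (of_real R * cis t) = R" for t using R by (simp add: norm_mult)
  have "(Re \<circ> (\<lambda>t. L (of_real R * cis t)) has_integral Re (2 * of_real pi * L 0)) {0..2*pi}"
    by (intro has_integral_linear[OF _ bounded_linear_Re] circle_mean_value LR R)
  then have mean: "((\<lambda>t. Re (L (of_real R * cis t))) has_integral 2 * pi * ln (cmod (G 0))) {0..2*pi}"
    using ReL[of 0] S(1) R by (simp add: o_def)
  have "?lp integrable_on {0..2*pi}"
    by (intro integrable_continuous_interval continuous_on_log_plus_circle holomorphic_on_imp_continuous_on h)
  then have lp: "(?lp has_integral 2 * pi * nevanlinna_T h R) {0..2*pi}"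
    by (simp add: nevanlinna_T_def has_integral_integrable_integral)
  have ReL_circ: "Re (L (of_real R * cis t)) = ln (cmod (h (of_real R * cis t)))" for t
    using ReL[of "of_real R * cis t"] Ghcirc[of "of_real R * cis t"] circ[of t] S(1) by simp
  \<comment> \<open>Jensen's inequality: the mean of \<open>ln (cmod h)\<close> on the circle equals
    \<open>ln (cmod (h 0)) + \<Lambda>\<close>, and \<open>ln\<close> is at most
    \<open>log_plus\<close>.\<close>
  have "2 * pi * ln (cmod (G 0)) \<le> 2 * pi * nevanlinna_T h R"
    by (rule has_integral_le[OF mean lp]) (simp add: ReL_circ log_plus_def)
  then have "ln (cmod (h 0)) + \<Lambda> \<le> nevanlinna_T h R" by (simp add: G0)
  moreover have "nevanlinna_T h R \<ge> 0"
    by (intro nevanlinna_T_nonneg holomorphic_on_imp_continuous_on h)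
  ultimately have \<Lambda>J: "\<Lambda> \<le> J" using J by linarith
  have \<Lambda>0: "\<Lambda> \<ge> 0" unfolding \<Lambda>_def using w by (intro sum_nonneg) (auto simp: less_imp_le)
  have "((\<lambda>t. 2 * ?lp t - Re (L (of_real R * cis t))) has_integral
      2 * (2 * pi * nevanlinna_T h R) - 2 * pi * ln (cmod (G 0))) {0..2*pi}"
    by (intro has_integral_diff has_integral_mult_right lp mean)
  moreover have "(\<lambda>t. 2 * ?lp t - Re (L (of_real R * cis t))) = (\<lambda>t. \<bar>Re (L (of_real R * cis t))\<bar>)"
    using sph circ by (auto simp: ReL_circ abs_ln_eq_log_plus)
  ultimately have "integral {0..2*pi} (\<lambda>t. \<bar>Re (L (of_real R * cis t))\<bar>) =
      2 * pi * (2 * nevanlinna_T h R - ln (cmod (G 0)))"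
    by (simp add: integral_unique algebra_simps)
  also have "\<dots> \<le> 2 * pi * J" using J G0 \<Lambda>0 by (intro mult_left_mono) auto
  finally have intL: "integral {0..2*pi} (\<lambda>t. \<bar>Re (L (of_real R * cis t))\<bar>) \<le> 2 * pi * J" .
  show ?thesis
  proof (rule that[of n w])
    fix z assume z: "cmod z \<le> R / 4" "z \<notin> w ` {..<n}"
    have zR: "cmod z < R" using z(1) R by linarith
    have zw: "z \<noteq> w i" if "i < n" for i using z(2) that by auto
    have hz: "h z \<noteq> 0" using zw g(2)[of z] zR by (auto simp: hg)
    let ?b = "\<lambda>i z. of_real R * (z - w i) / (of_real (R^2) - cnj (w i) * z)"
    let ?q = "\<lambda>i. of_real (R^2 - (cmod (w i))^2) / ((z - w i) * (of_real (R^2) - cnj (w i) * z))"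
    \<comment> \<open>This identity holds on a neighbourhood of \<open>z\<close>, so it may be
      differentiated: the logarithmic derivative of \<open>h\<close> splits into
      \<open>deriv L z\<close> and the Blaschke terms.\<close>
    have hL: "h v = exp (L v) * (\<Prod>i<n. ?b i v)" if v: "v \<in> ball 0 R" for v
    proof -
      have "(\<Prod>i<n. v - w i) = (\<Prod>i<n. (of_real (R^2) - cnj (w i) * v) / of_real R * ?b i v)"
        using nz[of _ v] v R by (intro prod.cong) auto
      then have "h v = G v * (\<Prod>i<n. ?b i v)"
        unfolding hg G_def prod.distrib by (simp add: mult_ac)
      then show ?thesis using L(2)[of v] v S(1) by simp
    qed
    have "(L has_field_derivative deriv L z) (at z)"
      using L(1) zR S(1) by (intro holomorphic_derivI[of L "ball 0 S"]) auto
    moreover have "((\<lambda>z. \<Prod>i<n. ?b i z) has_field_derivative (\<Prod>i<n. ?b i z) * (\<Sum>i<n. ?q i)) (at z)"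
      by (intro has_field_derivative_prod_log has_field_derivative_Blaschke_factor)
        (use zw nz zR in auto)
    ultimately have "((\<lambda>v. exp (L v) * (\<Prod>i<n. ?b i v)) has_field_derivative
        exp (L z) * (\<Prod>i<n. ?b i z) * (deriv L z + (\<Sum>i<n. ?q i))) (at z)"
      by (auto intro!: derivative_eq_intros simp: algebra_simps)
    then have "(h has_field_derivative h z * (deriv L z + (\<Sum>i<n. ?q i))) (at z)"
      by (subst (asm) has_field_derivative_cong_ev[where g = h, OF refl])
        (use hL zR eventually_nhds_in_open[of "ball 0 R" z] in \<open>auto elim!: eventually_mono\<close>)
    then have eq: "deriv h z / h z = deriv L z + (\<Sum>i<n. ?q i)"
      using hz by (simp add: DERIV_imp_deriv)
    have "cmod (deriv L z) \<le> R / (pi * (R - cmod z)^2) * (2 * pi * J)"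
      using deriv_le_integral_Re[OF LR zR] intL R
      by (elim order_trans) (intro mult_left_mono, auto)
    also have "\<dots> = 2 * R * J / (R - cmod z)^2" by simp
    \<comment> \<open>Here \<open>R - cmod z >= 3/4 * R\<close>, which gives 32/9, rounded up to
      4.\<close>
    also have "\<dots> \<le> 2 * R * J / (3/4 * R)^2"
      using z(1) R \<Lambda>J \<Lambda>0 zR by (intro divide_left_mono power_mono mult_nonneg_nonneg) auto
    also have "\<dots> = 32/9 * J / R" using R by (simp add: field_simps power2_eq_square)
    also have "\<dots> \<le> 4 * J / R" using R \<Lambda>J \<Lambda>0 by (intro divide_right_mono) auto
    finally have 1: "cmod (deriv L z) \<le> 4 * J / R" .
    have "cmod (\<Sum>i<n. ?q i) \<le> (\<Sum>i<n. 3 * (ln (R / cmod (w i)) / cmod (z - w i)))"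
      using norm_Blaschke_log_deriv_le w zw z(1) by (intro sum_norm_le) auto
    then have 2: "cmod (\<Sum>i<n. ?q i) \<le> 3 * (\<Sum>i<n. ln (R / cmod (w i)) / cmod (z - w i))"
      by (simp add: sum_distrib_left)
    show "h z \<noteq> 0 \<and> cmod (deriv h z / h z) \<le>
       4 * J / R + 3 * (\<Sum>i<n. ln (R / cmod (w i)) / cmod (z - w i))"
      unfolding eq using hz norm_triangle_ineq[of "deriv L z" "\<Sum>i<n. ?q i"] 1 2 by linarith
  qed (use w \<Lambda>J in \<open>auto simp: \<Lambda>_def\<close>)
qed

subsection \<open>Circles on which the logarithmic derivative is small\<close>

lemma sum_inverse_max_one_le: "n > 0 \<Longrightarrow> (\<Sum>j<n. 1 / max 1 (real j)) \<le> 2 + ln (real n)"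
proof -
  \<comment> \<open>Taking one term more starts the induction at \<open>n = 1\<close>, where the
    indices 0 and 1 contribute the constant 2. Each later term \<open>1 / (n + 1)\<close> is at most
    the increment of \<open>ln\<close>.\<close>
  have *: "(\<Sum>j<Suc n. 1 / max 1 (real j)) \<le> 2 + ln (real n)" if "n > 0" for n
    using that
  proof (induction n rule: nat_induct_non_zero)
    case (Suc n)
    have "1 / real (Suc n) \<le> ln (real (Suc n)) - ln (real n)"
      using ln_le_minus_one[of "real n / real (Suc n)"] Suc(1) by (simp add: ln_div field_simps)
    then show ?case using Suc by (simp add: max_def)
  qed simp
  assume "n > 0"
  moreover have "(\<Sum>j<n. 1 / max 1 (real j)) \<le> (\<Sum>j<Suc n. 1 / max 1 (real j))" by simp
  ultimately show ?thesis using *[of n] by linarith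
qed

lemma sum_inverse_dist_le:
  assumes "n > 0"
  shows "(\<Sum>j<n. 1 / max 1 \<bar>real (m + j) - x\<bar>) \<le> 2 * (2 + ln (real n))"
proof -
  define S where "S = (\<lambda>n. \<Sum>j<n. 1 / max 1 (real j))"
  have S: "S k \<le> 2 + ln (real n)" if "k \<le> n" for k
  proof -
    have "S k \<le> S n" unfolding S_def using that by (intro sum_mono2) auto
    then show ?thesis using sum_inverse_max_one_le[OF assms] unfolding S_def by linarith
  qed
  \<comment> \<open>The index \<open>k\<close> is the first one with \<open>m + j >= x\<close>,
    capped at \<open>n\<close>. Moving away from \<open>k\<close> on either side, the distances to
    \<open>x\<close> are at least 0, 1, 2, ..., so each side is dominated by a harmonic sum.\<close>
  define k where "k = min n (nat \<lceil>x - real m\<rceil>)"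
  have below: "real j < x - real m" if "j < k" for j
    using that unfolding k_def by linarith
  have above: "x - real m \<le> real j" if "k \<le> j" "j < n" for j
    using that unfolding k_def by linarith
  have "k \<le> n" by (simp add: k_def)
  have "{..<n} = {..<k} \<union> {k..<n}" using \<open>k \<le> n\<close> by auto
  moreover have "sum F ({..<k} \<union> {k..<n}) = sum F {..<k} + sum F {k..<n}" for F :: "nat \<Rightarrow> real"
    by (rule sum.union_disjoint) auto
  ultimately have "(\<Sum>j<n. 1 / max 1 \<bar>real (m + j) - x\<bar>) =
     (\<Sum>j<k. 1 / max 1 \<bar>real (m + j) - x\<bar>) + (\<Sum>j\<in>{k..<n}. 1 / max 1 \<bar>real (m + j) - x\<bar>)"
    by presburger
  moreover have "(\<Sum>j<k. 1 / max 1 \<bar>real (m + j) - x\<bar>) \<le> (\<Sum>j<k. 1 / max 1 (real (k - Suc j)))"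
  proof (intro sum_mono divide_left_mono)
    fix j assume "j \<in> {..<k}"
    then have "real (k - 1) < x - real m" "real (k - Suc j) = real (k - 1) - real j"
      using below[of "k - 1"] by auto
    then show "max 1 (real (k - Suc j)) \<le> max 1 \<bar>real (m + j) - x\<bar>" by auto
  qed auto
  moreover have "(\<Sum>j<k. 1 / max 1 (real (k - Suc j))) = S k"
    unfolding S_def by (rule sum.nat_diff_reindex)
  moreover have "(\<Sum>j\<in>{k..<n}. 1 / max 1 \<bar>real (m + j) - x\<bar>) =
      (\<Sum>j<n - k. 1 / max 1 \<bar>real (m + (k + j)) - x\<bar>)"
    by (subst sum.atLeastLessThan_shift_0) (simp add: atLeast0LessThan add_ac)
  moreover have "(\<Sum>j<n - k. 1 / max 1 \<bar>real (m + (k + j)) - x\<bar>) \<le> S (n - k)"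
    unfolding S_def
  proof (intro sum_mono divide_left_mono)
    fix j assume "j \<in> {..<n - k}"
    then have "x - real m \<le> real k" using above[of k] by auto
    then show "max 1 (real j) \<le> max 1 \<bar>real (m + (k + j)) - x\<bar>" by auto
  qed auto
  ultimately have "(\<Sum>j<n. 1 / max 1 \<bar>real (m + j) - x\<bar>) \<le> S k + S (n - k)"
    by (simp only: add_mono)
  also have "\<dots> \<le> (2 + ln (real n)) + (2 + ln (real n))"
    using S[OF \<open>k \<le> n\<close>] S[OF diff_le_self[of n k]] by (rule add_mono)
  finally show ?thesis by (simp only: mult_2)
qed

text \<open>An annulus of half-width \<open>K\<close> is required instead of a circle, so that the
  ball of radius \<open>K\<close> about any point of the circle lies in the controlled region and a
  shift by \<open>\<eta>\<close> can be followed.\<close>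

definition good_radius :: "(complex \<Rightarrow> complex) \<Rightarrow> real \<Rightarrow> real \<Rightarrow> real \<Rightarrow> bool" where
  "good_radius h \<epsilon> K r \<longleftrightarrow>
     (\<forall>z. \<bar>cmod z - r\<bar> \<le> K \<longrightarrow> h z \<noteq> 0 \<and> cmod (deriv h z / h z) \<le> \<epsilon>)"

text \<open>Only finitely many moduli of zeros occur up to \<open>b\<close>, while the interval is
  infinite. This supplies the zero-free outer circle that \<open>log_deriv_estimate\<close> asks
  for.\<close>

lemma ex_zero_free_circle:
  assumes "h holomorphic_on UNIV" "h z0 \<noteq> 0" "a < b"
  shows "\<exists>R\<in>{a..b}. \<forall>z. cmod z = R \<longrightarrow> h z \<noteq> 0"
proof -
  obtain n :: nat and w g where "\<And>z. z \<in> cball 0 b \<Longrightarrow> g z \<noteq> 0"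
    and hg: "\<And>z. h z = (\<Prod>i<n. z - w i) * g z"
    by (rule entire_factorization_on_compact[OF assms(1,2) compact_cball[of 0 b]]) (rule that; assumption)
  then have "h z \<noteq> 0" if "cmod z \<le> b" "z \<notin> w ` {..<n}" for z
    using that by auto
  moreover have "infinite {a..b}" using assms(3) by (simp add: infinite_Icc)
  then have "\<not> {a..b} \<subseteq> cmod ` w ` {..<n}" using finite_subset by blast
  then obtain R where "R \<in> {a..b}" "R \<notin> cmod ` w ` {..<n}" by blast
  ultimately show ?thesis by (intro bexI[of _ R]) auto
qed

text \<open>A small weighted sum at \<open>r\<close> forces every zero to be radially far from
  \<open>r\<close>. If \<open>cmod (w i) <= R / 2\<close>, its weight is at least
  \<open>ln 2 >= 1/2\<close>, so its distance is at least \<open>1 / (2 * e) >= 2 * K + 2\<close>;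
  the remaining zeros are far since \<open>r\<close> is well below \<open>R / 2\<close>. On the
  annulus \<open>cmod (z - w i)\<close> is then at least half the distance at \<open>r\<close>, and
  the total is \<open>e + 3 * (2 * e) = 7 * e\<close>.\<close>

lemma good_radius_of_weights:
  fixes w :: "nat \<Rightarrow> complex"
  assumes bnd: "\<And>z. cmod z \<le> R / 4 \<Longrightarrow> z \<notin> w ` {..<m} \<Longrightarrow> h z \<noteq> 0 \<and>
       cmod (deriv h z / h z) \<le> e + 3 * (\<Sum>i<m. ln (R / cmod (w i)) / cmod (z - w i))"
    and w: "\<And>i. i < m \<Longrightarrow> 0 < cmod (w i) \<and> cmod (w i) < R"
    and r: "r + K \<le> R / 4" "r + 2 * K + 2 \<le> R / 2"
    and K: "K \<ge> 0" "e * (4 * K + 4) \<le> 1" "e > 0"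
    and B: "(\<Sum>i<m. ln (R / cmod (w i)) * (1 / max 1 \<bar>r - cmod (w i)\<bar>)) \<le> e"
  shows "good_radius h (7 * e) K r"
  unfolding good_radius_def
proof (intro allI impI)
  fix z assume z: "\<bar>cmod z - r\<bar> \<le> K"
  have \<lambda>: "0 < ln (R / cmod (w i))" if "i < m" for i
    using w[OF that] by (intro ln_gt_zero) (simp add: pos_less_divide_eq)
  have far: "\<bar>r - cmod (w i)\<bar> \<ge> 2 * K + 2" if i: "i < m" for i
  proof (cases "cmod (w i) \<le> R / 2")
    case True
    have "1 / 2 \<le> ln (2::real)" using ln_le_minus_one[of "1/2::real"] by (simp add: ln_div)
    also have "\<dots> \<le> ln (R / cmod (w i))" using True w[OF i]
      by (intro ln_mono) (auto simp: pos_le_divide_eq)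
    finally have "1 / 2 * (1 / max 1 \<bar>r - cmod (w i)\<bar>) \<le> ln (R / cmod (w i)) * (1 / max 1 \<bar>r - cmod (w i)\<bar>)"
      by (intro mult_right_mono) auto
    also have "\<dots> \<le> (\<Sum>i<m. ln (R / cmod (w i)) * (1 / max 1 \<bar>r - cmod (w i)\<bar>))"
      using i \<lambda> by (intro member_le_sum) (auto intro!: divide_nonneg_nonneg simp: less_imp_le)
    also note B
    finally have "1 \<le> e * (2 * max 1 \<bar>r - cmod (w i)\<bar>)" by (simp add: field_simps max_def split: if_splits)
    then have "e * (4 * K + 4) \<le> e * (2 * max 1 \<bar>r - cmod (w i)\<bar>)" using K by linarith
    then show ?thesis using K by (simp add: max_def split: if_splits)
  next
    case False
    then show ?thesis using r by auto
  qed
  have half: "max 1 \<bar>r - cmod (w i)\<bar> / 2 \<le> cmod (z - w i)" if "i < m" for i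
    using far[OF that] z K(1) norm_triangle_ineq3[of z "w i"] by (auto simp: max_def)
  have "z \<notin> w ` {..<m}" using half by fastforce
  moreover have "cmod z \<le> R / 4" using z r by linarith
  ultimately have hz: "h z \<noteq> 0"
    "cmod (deriv h z / h z) \<le> e + 3 * (\<Sum>i<m. ln (R / cmod (w i)) / cmod (z - w i))"
    using bnd by auto
  have "(\<Sum>i<m. ln (R / cmod (w i)) / cmod (z - w i)) \<le>
      (\<Sum>i<m. ln (R / cmod (w i)) / (max 1 \<bar>r - cmod (w i)\<bar> / 2))"
    using half \<lambda> by (intro sum_mono divide_left_mono mult_pos_pos) (force simp: less_imp_le)+
  also have "\<dots> = 2 * (\<Sum>i<m. ln (R / cmod (w i)) * (1 / max 1 \<bar>r - cmod (w i)\<bar>))"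
    by (simp add: sum_distrib_left mult_ac)
  also have "\<dots> \<le> 2 * e" using B by simp
  finally show "h z \<noteq> 0 \<and> cmod (deriv h z / h z) \<le> 7 * e" using hz by auto
qed

text \<open>Markov's inequality for counting: every element violating \<open>P\<close> has
  \<open>B r > e\<close>.\<close>

lemma card_bad_le:
  fixes B :: "nat \<Rightarrow> real"
  assumes "finite A" "\<And>r. r \<in> A \<Longrightarrow> B r \<ge> 0" "(\<Sum>r\<in>A. B r) \<le> e * c" "e > 0"
    and "\<And>r. r \<in> A \<Longrightarrow> B r \<le> e \<Longrightarrow> P r"
  shows "real (card {r \<in> A. \<not> P r}) \<le> c"
proof -
  have "e * real (card {r \<in> A. \<not> P r}) = (\<Sum>r\<in>{r \<in> A. \<not> P r}. e)" by simp
  also have "\<dots> \<le> (\<Sum>r\<in>{r \<in> A. \<not> P r}. B r)" using assms(5) by (intro sum_mono) force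
  also have "\<dots> \<le> (\<Sum>r\<in>A. B r)" using assms(1,2) by (intro sum_mono2) auto
  also note assms(3)
  finally show ?thesis using assms(4) by simp
qed

text \<open>What is used of \<open>order_of f < 1\<close>; unlike the order it passes easily to \<open>f + c\<close> and to
  quotients by \<open>z\<^sup>m\<close>.\<close>
definition slow_growth :: "(complex \<Rightarrow> complex) \<Rightarrow> bool" where
  "slow_growth f \<longleftrightarrow> ((\<lambda>r. nevanlinna_T f r * ln r / r) \<longlongrightarrow> 0) at_top"

text \<open>Averaging: after interchanging sums, a zero contributes its weight times a harmonic sum
  \<open>O(ln n)\<close>, so the weighted sums over the \<open>n\<close> radii total
  \<open>O(J R * ln R)\<close>, which is \<open>o(n)\<close> by slow growth. Markov's inequality
  then bounds the bad radii. The proportion 1/4 leaves room for three functions to be good at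
  once.\<close>

lemma eventually_few_bad_radii_nonzero_at_0:
  assumes h: "h holomorphic_on UNIV" "h 0 \<noteq> 0" and slow: "slow_growth h" and "\<epsilon> > 0" "K \<ge> 0"
  shows "eventually (\<lambda>n. 4 * card {r \<in> {n..<2 * n}. \<not> good_radius h \<epsilon> K (real r)} \<le> n) sequentially"
proof -
  define J where "J = (\<lambda>R. 2 * nevanlinna_T h R + \<bar>ln (cmod (h 0))\<bar>)"
  have J0: "J R \<ge> 0" for R
    unfolding J_def using nevanlinna_T_nonneg[of h R] h(1) by (simp add: holomorphic_on_imp_continuous_on)
  \<comment> \<open>Both constraints come from \<open>good_radius_of_weights\<close>: its conclusion
    has \<open>7 * e\<close>, and its separation of zeros needs
    \<open>e * (4 * K + 4) <= 1\<close>.\<close>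
  define e where "e = min (\<epsilon> / 7) (1 / (4 * K + 4))"
  have e: "e > 0" "7 * e \<le> \<epsilon>" "e * (4 * K + 4) \<le> 1"
    using assms(4,5) by (auto simp: e_def min_def field_simps)
  have "((\<lambda>R. 2 * (2 / ln R + 1) * (nevanlinna_T h R * ln R / R) + \<bar>ln (cmod (h 0))\<bar> * ((2 + ln R) / R)) \<longlongrightarrow>
     2 * (0 + 1) * 0 + \<bar>ln (cmod (h 0))\<bar> * 0) at_top"
    by (intro tendsto_intros slow[unfolded slow_growth_def]; real_asymp)
  moreover have "eventually (\<lambda>R. 2 * (2 / ln R + 1) * (nevanlinna_T h R * ln R / R) +
      \<bar>ln (cmod (h 0))\<bar> * ((2 + ln R) / R) = J R * (2 + ln R) / R) at_top"
    using eventually_gt_at_top[of 1] by eventually_elim (simp add: J_def field_simps)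
  ultimately have "((\<lambda>R. J R * (2 + ln R) / R) \<longlongrightarrow> 0) at_top"
    by (simp add: filterlim_cong)
  \<comment> \<open>The constant is chosen so that
    \<open>2 * (e / 256) * (32 * n) = e * (n / 4)\<close>, where \<open>R <= 32 * n\<close>.\<close>
  then have "eventually (\<lambda>R. J R * (2 + ln R) / R < e / 256) at_top"
    using e(1) by (intro order_tendstoD) auto
  then obtain R0 where R0: "\<And>R. R \<ge> R0 \<Longrightarrow> J R * (2 + ln R) / R < e / 256"
    unfolding eventually_at_top_linorder by blast
  have "eventually (\<lambda>n. real n \<ge> max R0 (K + 1)) sequentially" by real_asymp
  then show ?thesis
  proof eventually_elim
    case (elim n)
    then have n: "real n \<ge> R0" "real n \<ge> K + 1" "real n \<ge> 1" "n > 0" using assms(5) by auto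
    \<comment> \<open>Since \<open>r < 2 * n\<close> and \<open>K < n\<close>, the factor 16 puts
      all the annuli inside radius \<open>R / 4\<close>. The range up to \<open>32 * n\<close>
      leaves freedom to avoid zeros on the circle.\<close>
    obtain R where R: "16 * real n \<le> R" "R \<le> 32 * real n" "\<And>z. cmod z = R \<Longrightarrow> h z \<noteq> 0"
      using ex_zero_free_circle[OF h, of "16 * real n" "32 * real n"] n by auto
    have R': "R > 0" "R \<ge> R0" "R \<ge> 1" using R n by auto
    have JR: "J R * (2 + ln R) \<le> e / 256 * R" using R0[OF R'(2)] R' by (simp add: field_simps)
    have TJ: "2 * nevanlinna_T h R - ln (cmod (h 0)) \<le> J R" by (simp add: J_def)
    obtain m :: nat and w where w: "\<And>i. i < m \<Longrightarrow> 0 < cmod (w i) \<and> cmod (w i) < R"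
      and wsum: "(\<Sum>i<m. ln (R / cmod (w i))) \<le> J R"
      and bnd: "\<And>z. cmod z \<le> R / 4 \<Longrightarrow> z \<notin> w ` {..<m} \<Longrightarrow> h z \<noteq> 0 \<and>
       cmod (deriv h z / h z) \<le> 4 * J R / R + 3 * (\<Sum>i<m. ln (R / cmod (w i)) / cmod (z - w i))"
      by (rule log_deriv_estimate[OF h R'(1) R(3) TJ]) (assumption | rule that; assumption)+
    have "J R * 2 \<le> J R * (2 + ln R)" using J0 R' by (intro mult_left_mono) auto
    moreover have "0 \<le> e * R" using e R' by simp
    ultimately have "4 * J R \<le> e * R" using JR by linarith
    then have Je: "4 * J R / R \<le> e" using R' by (simp add: field_simps)
    define B where "B = (\<lambda>r. \<Sum>i<m. ln (R / cmod (w i)) * (1 / max 1 \<bar>real r - cmod (w i)\<bar>))"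
    have \<lambda>: "0 < ln (R / cmod (w i))" if "i < m" for i
    using w[OF that] by (intro ln_gt_zero) (simp add: pos_less_divide_eq)
    have "real (card {r \<in> {n..<2 * n}. \<not> good_radius h \<epsilon> K (real r)}) \<le> real n / 4"
    proof (rule card_bad_le[where B = B and e = e])
      show "B r \<ge> 0" for r unfolding B_def
        using \<lambda> by (intro sum_nonneg mult_nonneg_nonneg) (auto simp: less_imp_le)
      have "(\<Sum>r\<in>{n..<2 * n}. B r) =
          (\<Sum>i<m. ln (R / cmod (w i)) * (\<Sum>r\<in>{n..<2 * n}. 1 / max 1 \<bar>real r - cmod (w i)\<bar>))"
        unfolding B_def sum_distrib_left by (rule sum.swap)
      also have "\<dots> \<le> (\<Sum>i<m. ln (R / cmod (w i)) * (2 * (2 + ln R)))"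
      proof (intro sum_mono mult_left_mono)
        fix i
        have "(\<Sum>r\<in>{n..<2 * n}. 1 / max 1 \<bar>real r - cmod (w i)\<bar>) =
            (\<Sum>j<n. 1 / max 1 \<bar>real (n + j) - cmod (w i)\<bar>)"
          by (subst sum.atLeastLessThan_shift_0) (simp add: atLeast0LessThan add_ac)
        also have "\<dots> \<le> 2 * (2 + ln (real n))" by (rule sum_inverse_dist_le[OF n(4)])
        also have "\<dots> \<le> 2 * (2 + ln R)" using R n by simp
        finally show "(\<Sum>r\<in>{n..<2 * n}. 1 / max 1 \<bar>real r - cmod (w i)\<bar>) \<le> 2 * (2 + ln R)" .
      qed (use \<lambda> in \<open>auto simp: less_imp_le\<close>)
      also have "\<dots> = (\<Sum>i<m. ln (R / cmod (w i))) * (2 * (2 + ln R))" by (simp only: sum_distrib_right)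
      also have "\<dots> \<le> J R * (2 * (2 + ln R))" using wsum R' by (intro mult_right_mono) auto
      also have "\<dots> = 2 * (J R * (2 + ln R))" by (simp only: mult.left_commute)
      also have "\<dots> \<le> 2 * (e / 256 * R)" using JR by (intro mult_left_mono) auto
      also have "\<dots> \<le> 2 * (e / 256 * (32 * real n))" using R e by (intro mult_left_mono) auto
      finally show "(\<Sum>r\<in>{n..<2 * n}. B r) \<le> e * (real n / 4)" by simp
      fix r assume r: "r \<in> {n..<2 * n}" "B r \<le> e"
      have "good_radius h (7 * e) K (real r)"
      proof (rule good_radius_of_weights[where R = R and w = w and m = m])
        show "real r + K \<le> R / 4" "real r + 2 * K + 2 \<le> R / 2" using r(1) R n by auto
        show "h z \<noteq> 0 \<and> cmod (deriv h z / h z) \<le> e + 3 * (\<Sum>i<m. ln (R / cmod (w i)) / cmod (z - w i))"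
          if "cmod z \<le> R / 4" "z \<notin> w ` {..<m}" for z using bnd[OF that] Je by linarith
      qed (use w e assms r in \<open>auto simp: B_def\<close>)
      then show "good_radius h \<epsilon> K (real r)"
        using e(2) unfolding good_radius_def by (meson order_trans)
    qed (use e in auto)
    then show ?case by linarith
  qed
qed

section \<open>Slow growth: comparison, zeros at the origin, and the order\<close>

lemma slow_growth_le:
  assumes "slow_growth f" "continuous_on UNIV h"
    and "\<And>r. r \<ge> 1 \<Longrightarrow> nevanlinna_T h r \<le> nevanlinna_T f r + c"
  shows "slow_growth h"
  unfolding slow_growth_def
proof (rule tendsto_sandwich[where f = "\<lambda>_. 0"
      and h = "\<lambda>r. nevanlinna_T f r * ln r / r + c * (ln r / r)"])
  have "((\<lambda>r. nevanlinna_T f r * ln r / r + c * (ln r / r)) \<longlongrightarrow> 0 + c * 0) at_top"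
    by (intro tendsto_intros assms(1)[unfolded slow_growth_def]; real_asymp)
  then show "((\<lambda>r. nevanlinna_T f r * ln r / r + c * (ln r / r)) \<longlongrightarrow> 0) at_top" by simp
  show "eventually (\<lambda>r. 0 \<le> nevanlinna_T h r * ln r / r) at_top"
    using eventually_ge_at_top[of 1]
    by eventually_elim (auto intro!: mult_nonneg_nonneg divide_nonneg_nonneg nevanlinna_T_nonneg assms)
  show "eventually (\<lambda>r. nevanlinna_T h r * ln r / r \<le> nevanlinna_T f r * ln r / r + c * (ln r / r)) at_top"
    using eventually_ge_at_top[of 1]
  proof eventually_elim
    case (elim r)
    then have "nevanlinna_T h r * (ln r / r) \<le> (nevanlinna_T f r + c) * (ln r / r)"
      using assms(3) by (intro mult_right_mono) auto
    then show ?case by (simp add: algebra_simps)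
  qed
qed auto

text \<open>A zero of order \<open>m\<close> at the origin is divided out. For \<open>r >= 1\<close>
  this does not increase the characteristic, and it changes the logarithmic derivative only by
  \<open>m / z\<close>, which is at most \<open>\<epsilon> / 2\<close> on large circles.\<close>

lemma eventually_few_bad_radii:
  assumes f: "f holomorphic_on UNIV" "f z0 \<noteq> 0" and slow: "slow_growth f" and "\<epsilon> > 0" "K \<ge> 0"
  shows "eventually (\<lambda>n. 4 * card {r \<in> {n..<2 * n}. \<not> good_radius f \<epsilon> K (real r)} \<le> n) sequentially"
proof -
  obtain m h where h: "h holomorphic_on UNIV" "h 0 \<noteq> 0" "\<And>z. f z = (z - 0) ^ m * h z"
    using entire_factor_zero[OF f] by metis
  have "nevanlinna_T h r \<le> nevanlinna_T f r + 0" if "r \<ge> 1" for r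
  proof (rule nevanlinna_T_mono)
    fix z assume "cmod z = \<bar>r\<bar>"
    then have "1 * cmod (h z) \<le> cmod z ^ m * cmod (h z)"
      using that by (intro mult_right_mono one_le_power) auto
    then show "log_plus (cmod (h z)) \<le> log_plus (cmod (f z)) + 0"
      by (simp add: h(3) norm_mult norm_power log_plus_mono)
  qed (intro holomorphic_on_imp_continuous_on f h)+
  then have "slow_growth h"
    using slow_growth_le[OF slow] h(1) holomorphic_on_imp_continuous_on by blast
  then have "eventually (\<lambda>n. 4 * card {r \<in> {n..<2 * n}. \<not> good_radius h (\<epsilon> / 2) K (real r)} \<le> n) sequentially"
    using eventually_few_bad_radii_nonzero_at_0 h assms by simp
  moreover have "eventually (\<lambda>n. real n \<ge> K + 1 + 2 * real m / \<epsilon>) sequentially" by real_asymp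
  ultimately show ?thesis
  proof eventually_elim
    case (elim n)
    have "good_radius f \<epsilon> K (real r)" if r: "r \<in> {n..<2*n}" "good_radius h (\<epsilon> / 2) K (real r)" for r
      unfolding good_radius_def
    proof (intro allI impI)
      fix z assume z: "\<bar>cmod z - real r\<bar> \<le> K"
      have "0 \<le> 2 * real m / \<epsilon>" using assms by simp
      moreover have "cmod z \<ge> 1 + 2 * real m / \<epsilon>" using z elim(2) r(1) by auto
      ultimately have "cmod z > 0" "2 * real m / \<epsilon> \<le> cmod z" by linarith+
      then have mz: "real m / cmod z \<le> \<epsilon> / 2" "z \<noteq> 0" using assms by (auto simp: field_simps)
      have hz: "h z \<noteq> 0" "cmod (deriv h z / h z) \<le> \<epsilon> / 2"
        using r(2) z by (auto simp: good_radius_def)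
      have "(h has_field_derivative deriv h z) (at z)"
        using h(1) by (intro holomorphic_derivI[of h UNIV]) auto
      then have "((\<lambda>z. z ^ m * h z) has_field_derivative z ^ m * deriv h z + real m * z ^ (m - 1) * h z) (at z)"
        by (auto intro!: derivative_eq_intros simp: algebra_simps)
      moreover have "f = (\<lambda>z. z ^ m * h z)" using h(3) by auto
      ultimately have "deriv f z = z ^ m * deriv h z + real m * z ^ (m - 1) * h z"
        by (intro DERIV_imp_deriv) simp
      then have eq: "deriv f z / f z = deriv h z / h z + of_nat m / z"
        using hz mz by (cases m) (auto simp: h(3) field_simps)
      have "cmod (of_nat m / z) \<le> \<epsilon> / 2" using mz by (simp add: norm_divide)
      then have "cmod (deriv f z / f z) \<le> \<epsilon>"
        unfolding eq using norm_triangle_ineq[of "deriv h z / h z" "of_nat m / z"] hz(2) by linarith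
      then show "f z \<noteq> 0 \<and> cmod (deriv f z / f z) \<le> \<epsilon>" using hz mz by (simp add: h(3))
    qed
    then have "card {r \<in> {n..<2 * n}. \<not> good_radius f \<epsilon> K (real r)} \<le>
        card {r \<in> {n..<2 * n}. \<not> good_radius h (\<epsilon> / 2) K (real r)}"
      by (intro card_mono) auto
    then show ?case using elim(1) by linarith
  qed
qed

text \<open>An exponent \<open>\<rho> < 1\<close> above the order gives
  \<open>nevanlinna_T f r <= r powr \<rho>\<close> for large \<open>r\<close>, and a power of
  \<open>r\<close> with negative exponent beats \<open>ln r\<close>.\<close>

lemma slow_growth_of_order_less_one:
  assumes "continuous_on UNIV f" "order_of f < 1"
  shows "slow_growth f"
proof -
  obtain q where "order_of f < q" "q < 1" using dense[OF assms(2)] by blast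
  then obtain \<rho>' where \<rho>': "order_of f < ereal \<rho>'" "\<rho>' < 1"
    by (cases q) auto
  define \<rho> where "\<rho> = max \<rho>' (1/2)"
  have \<rho>: "\<rho> < 1" "\<rho> > 0" using \<rho>' by (auto simp: \<rho>_def)
  have "eventually (\<lambda>r. ereal (log_plus (nevanlinna_T f r) / ln r) < ereal \<rho>') at_top"
    using \<rho>'(1) unfolding order_of_def by (rule Limsup_lessD)
  moreover have "eventually (\<lambda>r::real. r > 1) at_top" by (rule eventually_gt_at_top)
  ultimately have "eventually (\<lambda>r. norm (nevanlinna_T f r * ln r / r) \<le> r powr \<rho> * ln r / r) at_top"
  proof eventually_elim
    case (elim r)
    have T: "nevanlinna_T f r \<ge> 0" by (rule nevanlinna_T_nonneg[OF assms(1)])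
    have "nevanlinna_T f r \<le> r powr \<rho>"
    \<comment> \<open>The zero case is separate because \<open>exp (ln x) = x\<close> fails at 0,
      where \<open>ln 0 = 0\<close> by convention.\<close>
    proof (cases "nevanlinna_T f r = 0")
      case False
      have "ln (nevanlinna_T f r) \<le> log_plus (nevanlinna_T f r)" by (simp add: log_plus_def)
      also have "\<dots> \<le> \<rho>' * ln r" using elim by (simp add: field_simps)
      also have "\<dots> \<le> \<rho> * ln r" using elim by (intro mult_right_mono) (auto simp: \<rho>_def)
      finally have "exp (ln (nevanlinna_T f r)) \<le> exp (\<rho> * ln r)" by simp
      then show ?thesis using False T elim by (simp add: powr_def)
    qed simp
    then show ?case using T elim by (auto intro!: divide_right_mono mult_right_mono)
  qed
  moreover have "((\<lambda>r. r powr \<rho> * ln r / r) \<longlongrightarrow> 0) at_top" using \<rho> by real_asymp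
  ultimately show ?thesis unfolding slow_growth_def by (rule Lim_null_comparison)
qed

lemma slow_growth_add_const:
  assumes "slow_growth f" "continuous_on UNIV f"
  shows "slow_growth (\<lambda>z. f z + c)"
proof (rule slow_growth_le[OF assms(1)])
  show "continuous_on UNIV (\<lambda>z. f z + c)" by (intro continuous_intros assms)
  fix r :: real
  show "nevanlinna_T (\<lambda>z. f z + c) r \<le> nevanlinna_T f r + (log_plus (cmod c) + ln 2)"
  proof (rule nevanlinna_T_mono)
    fix z
    have "log_plus (cmod (f z + c)) \<le> log_plus (cmod (f z) + cmod c)"
      by (intro log_plus_mono norm_triangle_ineq) auto
    also have "\<dots> \<le> log_plus (cmod (f z)) + log_plus (cmod c) + ln 2" by (rule log_plus_add_le) auto
    finally show "log_plus (cmod (f z + c)) \<le> log_plus (cmod (f z)) + (log_plus (cmod c) + ln 2)"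
      by simp
  qed (intro continuous_intros assms)+
qed

subsection \<open>The shared-value theorem\<close>

text \<open>On \<open>ball z K\<close> the function \<open>h\<close> has a holomorphic logarithm
  whose derivative \<open>h' / h\<close> is bounded by \<open>\<epsilon>\<close>; the mean value
  inequality bounds its change from \<open>z\<close> to \<open>z + \<eta>\<close>.\<close>

lemma norm_shift_quotient_le:
  assumes h: "h holomorphic_on UNIV" and good: "good_radius h \<epsilon> K (cmod z)" and \<eta>: "cmod \<eta> < K"
  shows "cmod (h (z + \<eta>) / h z) \<le> exp (\<epsilon> * cmod \<eta>)"
proof -
  have good': "h w \<noteq> 0 \<and> cmod (deriv h w / h w) \<le> \<epsilon>" if "w \<in> ball z K" for w
    using good that norm_triangle_ineq3[of w z] unfolding good_radius_def
    by (auto simp: dist_norm norm_minus_commute)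
  have mem: "z \<in> ball z K" "z + \<eta> \<in> ball z K"
    using \<eta> norm_ge_zero[of \<eta>] by (auto simp: dist_norm simp del: norm_ge_zero)
  obtain L where L: "L holomorphic_on ball z K" "\<And>w. w \<in> ball z K \<Longrightarrow> exp (L w) = h w"
    by (rule holomorphic_logarithm_exists[of "ball z K" h z])
      (use good' mem holomorphic_on_subset[OF h] in auto)
  have "cmod (L (z + \<eta>) - L z) \<le> \<epsilon> * cmod (z + \<eta> - z)"
  proof (rule field_differentiable_bound[OF convex_ball[of z K]])
    fix w assume w: "w \<in> ball z K"
    have dL: "(L has_field_derivative deriv L w) (at w)"
      using L(1) w by (intro holomorphic_derivI[of L "ball z K"]) auto
    then show "(L has_field_derivative deriv L w) (at w within ball z K)"
      by (rule has_field_derivative_at_within)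
    have "((\<lambda>w. exp (L w)) has_field_derivative exp (L w) * deriv L w) (at w)"
      by (rule DERIV_fun_exp[OF dL])
    moreover have ev: "eventually (\<lambda>v. exp (L v) = h v) (nhds w)"
      using eventually_nhds_in_open[of "ball z K" w] w L(2) by (auto elim!: eventually_mono)
    ultimately have "(h has_field_derivative exp (L w) * deriv L w) (at w)"
      using DERIV_cong_ev[OF refl ev refl] by (simp only:)
    then have "deriv h w = h w * deriv L w" using L(2)[OF w] DERIV_imp_deriv by metis
    then have "deriv h w / h w = deriv L w" using good'[OF w] by simp
    then show "cmod (deriv L w) \<le> \<epsilon>" using good'[OF w] by simp
  qed (use mem in auto)
  moreover have "h (z + \<eta>) / h z = exp (L (z + \<eta>) - L z)"
    using L(2) mem by (simp add: exp_diff)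
  ultimately show ?thesis
    using norm_exp[of "L (z + \<eta>) - L z"] by (simp add: order_trans[OF norm_exp])
qed

text \<open>A general \<open>b\<close> serves both \<open>a\<close> and \<open>- a\<close>. If
  \<open>f - b\<close> vanishes to order \<open>m\<close> at \<open>p\<close>, the numerator gains
  \<open>m - 1\<close> powers of \<open>z - p\<close> from \<open>deriv f\<close> and at least one
  from \<open>f - g\<close>, whatever the multiplicity for \<open>g\<close>. The factor
  \<open>f + b\<close> takes the value \<open>2 * b\<close>, which is nonzero, at
  \<open>p\<close>.\<close>

lemma shared_zero_removable:
  assumes f: "f holomorphic_on UNIV" "\<not> f constant_on UNIV" and g: "g holomorphic_on UNIV"
    and p: "f p = b" "g p = b" and b: "b \<noteq> 0"
  shows "\<exists>r>0. \<exists>\<psi>. \<psi> holomorphic_on ball p r \<and>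
    (\<forall>z\<in>ball p r - {p}. deriv f z * (f z - g z) / ((f z - b) * (f z + b)) = \<psi> z)"
proof -
  have hol: "(\<lambda>z. f z - b) holomorphic_on UNIV" by (intro holomorphic_intros f(1))
  have zero: "f p - b = 0" using p(1) by simp
  have "\<not> (\<lambda>z. f z - b) constant_on UNIV"
    using f(2) by (auto simp: constant_on_def diff_eq_eq)
  then obtain q r m where q: "0 < m" "0 < r" "q holomorphic_on ball p r"
      "\<And>w. w \<in> ball p r \<Longrightarrow> f w - b = (w - p) ^ m * q w" "\<And>w. w \<in> ball p r \<Longrightarrow> q w \<noteq> 0"
    by (rule holomorphic_factor_zero_nonconstant[OF hol open_UNIV connected_UNIV UNIV_I zero])
      (assumption | rule that; assumption)+
  have "open ((\<lambda>z. f z + b) -` (- {0}))"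
    using f(1) by (intro open_vimage holomorphic_on_imp_continuous_on holomorphic_intros) auto
  moreover have "p \<in> (\<lambda>z. f z + b) -` (- {0})" using p b by simp
  ultimately obtain r' where r': "r' > 0" "ball p r' \<subseteq> (\<lambda>z. f z + b) -` (- {0})"
    by (meson openE)
  define k where "k = (\<lambda>z. if z = p then deriv (\<lambda>z. f z - g z) p else ((f z - g z) - (f p - g p)) / (z - p))"
  have k: "k holomorphic_on UNIV" unfolding k_def
    using f g by (intro pole_lemma_open[of "\<lambda>z. f z - g z" UNIV p] holomorphic_intros) auto
  have dk: "f z - g z = (z - p) * k z" for z using p by (simp add: k_def)
  define s where "s = min r r'"
  \<comment> \<open>This is the quotient after cancelling \<open>(z - p) ^ m\<close>, with
    \<open>k\<close> the difference quotient of \<open>f - g\<close> at \<open>p\<close>.\<close>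
  define \<psi> where "\<psi> = (\<lambda>z. (of_nat m * q z + (z - p) * deriv q z) * k z / (q z * (f z + b)))"
  have s: "s > 0" "ball p s \<subseteq> ball p r" using q r' by (auto simp: s_def)
  have fb: "f z + b \<noteq> 0" if "z \<in> ball p s" for z using r' that by (auto simp: s_def)
  have "\<psi> holomorphic_on ball p s" unfolding \<psi>_def
    using fb q(5) s by (intro holomorphic_intros holomorphic_on_subset[OF q(3)] holomorphic_on_subset[OF k]
      holomorphic_on_subset[OF f(1)] holomorphic_on_subset[OF holomorphic_deriv[OF q(3)]]) auto
  moreover have "deriv f z * (f z - g z) / ((f z - b) * (f z + b)) = \<psi> z" if z: "z \<in> ball p s - {p}" for z
  proof -
    have zr: "z \<in> ball p r" "z \<noteq> p" using z s by auto
    have "(q has_field_derivative deriv q z) (at z)"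
      using q(3) zr by (intro holomorphic_derivI[of q "ball p r"]) auto
    then have "((\<lambda>w. b + (w - p) ^ m * q w) has_field_derivative
        (z - p) ^ m * deriv q z + of_nat m * (z - p) ^ (m - 1) * q z) (at z)"
      by (auto intro!: derivative_eq_intros simp: algebra_simps)
    moreover have ev: "eventually (\<lambda>w. b + (w - p) ^ m * q w = f w) (nhds z)"
      using eventually_nhds_in_open[of "ball p r" z] zr q(4)[symmetric] by (auto elim!: eventually_mono)
    ultimately have "(f has_field_derivative
        (z - p) ^ m * deriv q z + of_nat m * (z - p) ^ (m - 1) * q z) (at z)"
      using DERIV_cong_ev[OF refl ev refl] by (simp only:)
    then have d: "deriv f z = (z - p) ^ m * deriv q z + of_nat m * (z - p) ^ (m - 1) * q z"
      by (rule DERIV_imp_deriv)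
    obtain l where l: "m = Suc l" using q(1) by (cases m) auto
    define c where "c = (z - p) ^ m"
    have "c \<noteq> 0" using zr by (simp add: c_def)
    have "deriv f z * (f z - g z) = c * ((of_nat m * q z + (z - p) * deriv q z) * k z)"
      unfolding d dk c_def l by (simp add: algebra_simps)
    moreover have "(f z - b) * (f z + b) = c * (q z * (f z + b))"
      unfolding q(4)[OF zr(1)] c_def by (simp only: mult.assoc)
    ultimately show ?thesis
      unfolding \<psi>_def by (simp only: mult_divide_mult_cancel_left[OF \<open>c \<noteq> 0\<close>])
  qed
  ultimately show ?thesis using s(1) by blast
qed

text \<open>\<open>remove_sings\<close> depends only on punctured neighbourhoods, so near
  \<open>p\<close> it agrees with that of the holomorphic \<open>\<psi>\<close>. The values which
  \<open>u\<close> takes at zeros of its denominator, by the convention for division by zero, are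
  therefore harmless.\<close>

lemma entire_extension:
  assumes "\<And>p. \<exists>r>0. \<exists>\<psi>. \<psi> holomorphic_on ball p r \<and> (\<forall>z\<in>ball p r - {p}. u z = \<psi> z)"
  shows "remove_sings u holomorphic_on UNIV"
proof -
  have "remove_sings u analytic_on {p}" for p
  proof -
    obtain r \<psi> where r: "r > 0" "\<psi> holomorphic_on ball p r" "\<And>z. z \<in> ball p r - {p} \<Longrightarrow> u z = \<psi> z"
      using assms by blast
    have ev: "eventually (\<lambda>z. u z = \<psi> z) (at p)"
      using eventually_at_in_open[of "ball p r" p] r by (auto elim!: eventually_mono)
    have an: "\<psi> analytic_on {p}" using r by (auto simp: analytic_on_def intro!: exI[of _ r])
    have "remove_sings \<psi> analytic_on {p}" using an by (rule remove_sings_analytic_on)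
    moreover have "eventually (\<lambda>z. remove_sings u z = remove_sings \<psi> z) (nhds p)"
    proof -
      have "eventually (\<lambda>z. z \<in> ball p r - {p}) (at p)"
        using eventually_at_in_open[of "ball p r" p] r by auto
      then have "eventually (\<lambda>z. remove_sings u z = remove_sings \<psi> z) (at p)"
      proof eventually_elim
        case (elim z)
        have "eventually (\<lambda>w. w \<in> ball p r - {p}) (nhds z)"
          using elim by (intro eventually_nhds_in_open) auto
        then have "eventually (\<lambda>w. u w = \<psi> w) (nhds z)" by (rule eventually_mono) (use r(3) in auto)
        then have "eventually (\<lambda>w. u w = \<psi> w) (at z)" by (simp add: eventually_at_filter eventually_mono)
        then show ?case by (rule remove_sings_cong) simp
      qed
      moreover have "remove_sings u p = remove_sings \<psi> p" using ev by (rule remove_sings_cong) simp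
      ultimately show ?thesis by (simp add: eventually_nhds_conv_at)
    qed
    ultimately show ?thesis using analytic_at_cong by blast
  qed
  then show ?thesis by (metis analytic_imp_holomorphic analytic_on_analytic_at)
qed

lemma entire_zero_if_small_on_circles:
  assumes \<Phi>: "\<Phi> holomorphic_on UNIV"
    and small: "\<And>\<delta> N. \<delta> > 0 \<Longrightarrow> \<exists>r\<ge>N. \<forall>z. cmod z = r \<longrightarrow> cmod (\<Phi> z) \<le> \<delta>"
  shows "\<Phi> z = 0"
proof -
  have "cmod (\<Phi> z) \<le> 0 + \<delta>" if \<delta>: "\<delta> > 0" for \<delta>
  proof -
    obtain r where r: "r \<ge> cmod z + 1" "\<And>w. cmod w = r \<Longrightarrow> cmod (\<Phi> w) \<le> \<delta>"
      using small[OF \<delta>] by blast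
    have "r > 0" using r(1) norm_ge_zero[of z] by linarith
    show ?thesis
    proof (rule maximum_modulus_frontier[of \<Phi> "cball 0 r"])
      show "continuous_on (closure (cball 0 r)) \<Phi>"
        using \<Phi> by (intro holomorphic_on_imp_continuous_on holomorphic_on_subset[OF \<Phi>]) auto
      show "cmod (\<Phi> w) \<le> 0 + \<delta>" if "w \<in> frontier (cball 0 r)" for w
        using that r \<open>r > 0\<close> by (simp add: frontier_cball)
    qed (use r holomorphic_on_subset[OF \<Phi>] in auto)
  qed
  then have "cmod (\<Phi> z) \<le> 0" by (rule field_le_epsilon)
  then show ?thesis by simp
qed

theorem theorem10:
  fixes f :: "complex \<Rightarrow> complex" and \<eta> a :: complex
  assumes "f holomorphic_on UNIV"
    and "\<not> (\<exists>c. \<forall>z. f z = c)"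
    and "order_of f < 1"
    and "\<eta> \<noteq> 0"
    and "a \<noteq> 0"
    and "shares_IM f (\<lambda>z. f (z + \<eta>) - f z) a"
    and "shares_IM f (\<lambda>z. f (z + \<eta>) - f z) (- a)"
  shows "\<forall>z. f z = f (z + \<eta>) - f z"
proof -
  define g where "g = (\<lambda>z. f (z + \<eta>) - f z)"
  define u where "u = (\<lambda>z. deriv f z * (f z - g z) / ((f z - a) * (f z + a)))"
  have f: "f holomorphic_on UNIV" by fact
  have cont: "continuous_on UNIV f" using f by (rule holomorphic_on_imp_continuous_on)
  have nonconst: "\<not> f constant_on UNIV" using assms(2) by (auto simp: constant_on_def)
  have g: "g holomorphic_on UNIV"
  proof -
    have "(\<lambda>z. z + \<eta>) holomorphic_on UNIV" by (intro holomorphic_intros)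
    then have "(f \<circ> (\<lambda>z. z + \<eta>)) holomorphic_on UNIV"
      by (rule holomorphic_on_compose) (rule holomorphic_on_subset[OF f], simp)
    then show ?thesis unfolding g_def o_def by (intro holomorphic_intros f)
  qed
  have df: "(f has_field_derivative deriv f z) (at z)" for z
    using f by (intro holomorphic_derivI[of f UNIV]) auto
  have share: "f z = c \<longleftrightarrow> g z = c" if "c = a \<or> c = - a" for c z
    using assms(6,7) that unfolding shares_IM_def g_def by auto

  have "\<exists>r>0. \<exists>\<psi>. \<psi> holomorphic_on ball p r \<and> (\<forall>z\<in>ball p r - {p}. u z = \<psi> z)" for p
  proof -
    consider "f p = a" | "f p = - a" | "(f p - a) * (f p + a) \<noteq> 0"
      by (auto simp: eq_neg_iff_add_eq_0)
    then show ?thesis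
    proof cases
      case 1
      then show ?thesis unfolding u_def
        by (intro shared_zero_removable f nonconst g share[THEN iffD1] assms(5)) auto
    next
      case 2
      then have "\<exists>r>0. \<exists>\<psi>. \<psi> holomorphic_on ball p r \<and>
          (\<forall>z\<in>ball p r - {p}. deriv f z * (f z - g z) / ((f z - (-a)) * (f z + (-a))) = \<psi> z)"
        by (intro shared_zero_removable f nonconst g share[THEN iffD1]) (use assms(5) in auto)
      then show ?thesis unfolding u_def by (simp add: mult.commute)
    next
      case 3
      have "open ((\<lambda>z. (f z - a) * (f z + a)) -` (- {0}))"
        using cont by (intro open_vimage continuous_intros) auto
      then obtain r where r: "r > 0" "ball p r \<subseteq> (\<lambda>z. (f z - a) * (f z + a)) -` (- {0})"
        using 3 by (metis (no_types, lifting) ComplI openE singletonD vimage_eq)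
      have "u holomorphic_on ball p r" unfolding u_def
        using r(2) by (intro holomorphic_intros holomorphic_on_subset[OF f] holomorphic_on_subset[OF g]
            holomorphic_on_subset[OF holomorphic_deriv[OF f]]) auto
      then show ?thesis using r(1) by blast
    qed
  qed
  then have \<Phi>: "remove_sings u holomorphic_on UNIV" by (rule entire_extension)
  have \<Phi>u: "remove_sings u z = u z" if "(f z - a) * (f z + a) \<noteq> 0" for z
  proof -
    have "open ((\<lambda>z. (f z - a) * (f z + a)) -` (- {0}))" (is "open ?U")
      using cont by (intro open_vimage continuous_intros) auto
    moreover have "u holomorphic_on ?U" unfolding u_def
      by (intro holomorphic_intros holomorphic_on_subset[OF f] holomorphic_on_subset[OF g]
            holomorphic_on_subset[OF holomorphic_deriv[OF f]]) auto
    ultimately have "u analytic_on {z}" using that analytic_at by fastforce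
    then show ?thesis by (rule remove_sings_at_analytic)
  qed

  have "remove_sings u z = 0" for z
  proof (rule entire_zero_if_small_on_circles[OF \<Phi>])
    fix \<delta> N :: real assume "\<delta> > 0"
    \<comment> \<open>The final bound is \<open>\<epsilon> * (2 + exp (cmod \<eta>))\<close>; the
      cap at 1 allows \<open>exp (\<epsilon> * cmod \<eta>)\<close> to be replaced by
      \<open>exp (cmod \<eta>)\<close>.\<close>
    define \<epsilon> where "\<epsilon> = min 1 (\<delta> / (2 + exp (cmod \<eta>)))"
    have pos: "2 + exp (cmod \<eta>) > 0" by (rule add_pos_pos) auto
    then have \<epsilon>: "\<epsilon> > 0" "\<epsilon> \<le> 1" using \<open>\<delta> > 0\<close> by (auto simp: \<epsilon>_def)
    have "\<epsilon> \<le> \<delta> / (2 + exp (cmod \<eta>))" by (simp add: \<epsilon>_def)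
    then have \<epsilon>\<delta>: "\<epsilon> * (2 + exp (cmod \<eta>)) \<le> \<delta>" using pos by (simp add: pos_le_divide_eq)
    define K where "K = cmod \<eta> + 1"
    define bad where "bad = (\<lambda>c n. {r \<in> {n..<2 * n}. \<not> good_radius (\<lambda>z. f z + c) \<epsilon> K (real r)})"
    have ev: "eventually (\<lambda>n. 4 * card (bad c n) \<le> n) sequentially" for c
    proof -
      obtain z0 where z0: "f z0 + c \<noteq> 0" using assms(2) by (metis add_eq_0_iff2)
      show ?thesis unfolding bad_def
      proof (rule eventually_few_bad_radii[where f = "\<lambda>z. f z + c" and ?z0.0 = z0])
        show "(\<lambda>z. f z + c) holomorphic_on UNIV" by (intro holomorphic_intros f)
        show "slow_growth (\<lambda>z. f z + c)"
          by (intro slow_growth_add_const slow_growth_of_order_less_one cont assms(3))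
      qed (use \<epsilon>(1) z0 in \<open>auto simp: K_def\<close>)
    qed
    have "eventually (\<lambda>n. 4 * card (bad 0 n) \<le> n \<and> 4 * card (bad a n) \<le> n \<and>
        4 * card (bad (-a) n) \<le> n \<and> real n \<ge> max N 1) sequentially"
      by (intro eventually_conj ev) real_asymp
    then obtain n where n: "4 * card (bad 0 n) \<le> n" "4 * card (bad a n) \<le> n"
        "4 * card (bad (-a) n) \<le> n" "real n \<ge> N" "n \<ge> 1"
      by (auto simp: eventually_sequentially)
    \<comment> \<open>The three bad sets cover at most \<open>3/4 * n\<close> of the
      \<open>n\<close> radii, so some radius is good for \<open>f\<close>, \<open>f + a\<close> and
      \<open>f - a\<close> simultaneously.\<close>
    have "card (bad 0 n \<union> bad a n \<union> bad (-a) n) \<le> card (bad 0 n) + card (bad a n) + card (bad (-a) n)"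
      by (meson card_Un_le add_mono order_trans order_refl)
    also have "\<dots> < card {n..<2 * n}" using n by simp
    finally have "\<not> {n..<2 * n} \<subseteq> bad 0 n \<union> bad a n \<union> bad (-a) n"
      using card_mono[of "bad 0 n \<union> bad a n \<union> bad (-a) n" "{n..<2 * n}"] by (auto simp: bad_def not_le)
    then obtain r where r: "r \<in> {n..<2 * n}" "r \<notin> bad 0 n" "r \<notin> bad a n" "r \<notin> bad (-a) n" by blast
    then have good: "good_radius (\<lambda>z. f z + c) \<epsilon> K (real r)" if "c \<in> {0, a, -a}" for c
      using that by (auto simp: bad_def)
    have "cmod (remove_sings u z) \<le> \<delta>" if z: "cmod z = real r" for z
    proof -
      have zK: "\<bar>cmod z - real r\<bar> \<le> K" using z by (simp add: K_def)
      have "deriv (\<lambda>z. f z + c) z = deriv f z" for c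
        by (rule DERIV_imp_deriv) (auto intro!: derivative_eq_intros df)
      then have c: "f z + c \<noteq> 0" "cmod (deriv f z / (f z + c)) \<le> \<epsilon>" if "c \<in> {0, a, -a}" for c
        using good[OF that] zK unfolding good_radius_def by auto
      have nz: "f z \<noteq> 0" "f z - a \<noteq> 0" "f z + a \<noteq> 0" using c(1)[of 0] c(1)[of a] c(1)[of "-a"] by auto
      have 1: "cmod (f (z + \<eta>) / f z) \<le> exp (\<epsilon> * cmod \<eta>)"
        using norm_shift_quotient_le[of f \<epsilon> K z \<eta>] f good[of 0] z by (simp add: K_def)
      have "exp (\<epsilon> * cmod \<eta>) \<le> exp (cmod \<eta>)" using \<epsilon> by (simp add: mult_left_le_one_le)
      with 1 have 2: "cmod (2 - f (z + \<eta>) / f z) \<le> 2 + exp (cmod \<eta>)"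
        using norm_triangle_ineq4[of 2 "f (z + \<eta>) / f z"] unfolding norm_numeral by linarith
      have 3: "cmod (deriv f z / (f z - a) + deriv f z / (f z + a)) \<le> 2 * \<epsilon>"
        using c(2)[of a] c(2)[of "-a"] norm_triangle_ineq[of "deriv f z / (f z - a)" "deriv f z / (f z + a)"]
        by simp
      \<comment> \<open>Partial fractions give \<open>f / (f^2 - a^2)\<close> as half the sum of
        \<open>1 / (f - a)\<close> and \<open>1 / (f + a)\<close>; the other factor is
        \<open>1 - g / f = 2 - f (z + \<eta>) / f z\<close>.\<close>
      have ueq: "u z = (deriv f z / (f z - a) + deriv f z / (f z + a)) / 2 * (2 - f (z + \<eta>) / f z)"
        unfolding u_def g_def using nz by (simp add: divide_simps) (simp add: algebra_simps)
      have "cmod (u z) = cmod (deriv f z / (f z - a) + deriv f z / (f z + a)) / 2 *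
          cmod (2 - f (z + \<eta>) / f z)"
        unfolding ueq norm_mult norm_divide norm_numeral ..
      also have "\<dots> \<le> \<epsilon> * (2 + exp (cmod \<eta>))"
        using 2 3 \<epsilon> by (intro mult_mono) auto
      also note \<epsilon>\<delta>
      finally show ?thesis using \<Phi>u[of z] nz by simp
    qed
    then show "\<exists>r\<ge>N. \<forall>z. cmod z = r \<longrightarrow> cmod (remove_sings u z) \<le> \<delta>"
      using r(1) n(4) by (intro exI[of _ "real r"]) auto
  qed
  \<comment> \<open>Where \<open>f\<close> and \<open>g\<close> differ, sharing excludes
    \<open>f z = a\<close> and \<open>f z = - a\<close>. The denominator of \<open>u\<close> is then
    nonzero, so \<open>u z = 0\<close> leaves only \<open>deriv f z = 0\<close>.\<close>
  then have prod0: "deriv f z = 0" if "f z \<noteq> g z" for z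
  proof -
    have "f z \<noteq> a" "f z \<noteq> - a" using that share[of a z] share[of "-a" z] by metis+
    then have nz: "(f z - a) * (f z + a) \<noteq> 0" by (simp add: eq_neg_iff_add_eq_0)
    then have "u z = 0" using \<Phi>u[of z] \<open>remove_sings u z = 0\<close> by simp
    then show ?thesis using nz that by (simp add: u_def)
  qed
  have "f z = g z" for z
  proof (rule ccontr)
    assume "f z \<noteq> g z"
    \<comment> \<open>A single point with \<open>f z \<noteq> g z\<close> yields an open set on
      which \<open>deriv f\<close> vanishes. By the identity theorem \<open>deriv f\<close> is zero
      everywhere, contradicting that \<open>f\<close> is not constant.\<close>
    have "open ((\<lambda>z. f z - g z) -` (- {0}))"
      using f g by (intro open_vimage holomorphic_on_imp_continuous_on holomorphic_intros) auto
    then have "z islimpt ((\<lambda>z. f z - g z) -` (- {0}))"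
      using \<open>f z \<noteq> g z\<close> by (intro interior_limit_point) (simp add: interior_open)
    moreover have "deriv f holomorphic_on UNIV" using f by (rule holomorphic_deriv) simp
    moreover have "deriv f v = 0" if "v \<in> (\<lambda>z. f z - g z) -` (- {0})" for v
      using that prod0[of v] by simp
    ultimately have "deriv f w = 0" for w
      using analytic_continuation[OF _ open_UNIV connected_UNIV subset_UNIV UNIV_I _ _ UNIV_I] by blast
    then have "(f has_field_derivative 0) (at w)" for w using df[of w] by simp
    then have "\<exists>c. \<forall>w\<in>UNIV. f w = c" by (intro has_field_derivative_zero_constant) auto
    then show False using assms(2) by simp
  qed
  then show ?thesis by (simp add: g_def)
qed

end
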